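(* There exists a positive absolute constant $c$ with the following property. If $m,f,g$ are non-negative integrable functions with positive integrals on $\mathbb{R}$ such that $m$ is log-concave, $m\left(\frac{r+s}{2}\right)\geq \sqrt{f(r)g(s)}$ for $r,s\in\mathbb{R}$, and $$\int_{\mathbb{R}} m\leq (1+\varepsilon)\sqrt{\int_{\mathbb{R}} f\cdot\int_{\mathbb{R}} g}$$ for $\varepsilon>0$, then there exist $a>0$ and $b\in\mathbb{R}$ such that $$\int_{\mathbb{R}}|f(t)-a\,m(t+b)|\,dt\leq c\cdot\sqrt[3]{\varepsilon}\,|\ln\varepsilon|^{\frac43}\cdot a\cdot\int_{\mathbb{R}}m(t)\,dt$$ and $$\int_{\mathbb{R}}|g(t)-a^{-1}m(t-b)|\,dt\leq c\cdot\sqrt[3]{\varepsilon}\,|\ln\varepsilon|^{\frac43}\cdot a^{-1}\cdot\int_{\mathbb{R}}m(t)\,dt.$$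
   Context: A non-negative real function $h$ on $\mathbb{R}$ is called log-concave if $h((1-\lambda)x+\lambda y)\geq h(x)^{1-\lambda}h(y)^{\lambda}$ for all $x,y\in\mathbb{R}$ and $\lambda\in(0,1)$.
   Formalization: In both bounds |ln ε| is replaced by max(1, |ln ε|), which differs only for 1/e < ε < e; the printed bound fails at ε = 1, where its right side is 0, e.g. for m = exp(-t²), f = g = (2/3)m. *)

theory Defs
  imports "HOL-Analysis.Analysis"
begin

text \<open>Both exponents are positive, so \<open>0 powr p = 0\<close> makes the inequality
  reduce to non-negativity of \<open>h\<close> whenever \<open>h x = 0\<close> or \<open>h y = 0\<close>.\<close>

definition log_concave :: "(real \<Rightarrow> real) \<Rightarrow> bool" where
  "log_concave h \<longleftrightarrow>
     (\<forall>x. 0 \<le> h x) \<and>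
     (\<forall>x y l. 0 < l \<and> l < 1 \<longrightarrow>
        h ((1 - l) * x + l * y) \<ge> h x powr (1 - l) * h y powr l)"

text \<open>The stability theorem for the Prekopa-Leindler inequality is usually printed with the error
  term \<open>root 3 \<epsilon> * \<bar>ln \<epsilon>\<bar> powr (4 / 3)\<close>. This vanishes at \<open>\<epsilon> = 1\<close>, and no constant makes that
  bound true near \<open>\<epsilon> = 1\<close> (take \<open>f = g = 2/3 m\<close>). The theorem is stated with
  \<open>max 1 \<bar>ln \<epsilon>\<bar>\<close> for \<open>\<bar>ln \<epsilon>\<bar>\<close>, which changes nothing unless \<open>1/e < \<epsilon> < e\<close>.\<close>

end

theory Submission imports Defs begin

text \<open>
  The proof makes the transport proof of the Prekopa-Leindler inequality quantitative and yields the
  bound \<open>37 * root 3 \<epsilon>\<close>, without any logarithmic factor.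

  Suppose first that \<open>f\<close> and \<open>g\<close> are log-concave probability densities with quantile functions \<open>X\<close>
  and \<open>Y\<close>. Then \<open>X' = 1 / f (X)\<close> and \<open>Y' = 1 / g (Y)\<close>, and substituting \<open>S = (X + Y) / 2\<close> in the
  integral of \<open>m\<close> gives
  \<open>\<integral>m \<ge> \<integral>\<^sub>0\<^sup>1 m (S) S' \<ge> \<integral>\<^sub>0\<^sup>1 (X' + Y') / (2 sqrt (X' Y')) \<ge> 1\<close>.
  If \<open>\<integral>m \<le> 1 + \<epsilon>\<close>, then the deficit \<open>(X' + Y') / (2 sqrt (X' Y')) - 1\<close> has integral at most \<open>\<epsilon>\<close>, so
  \<open>X'\<close> and \<open>Y'\<close> are close on average. Log-concavity bounds \<open>X'\<close> and \<open>Y'\<close> by a multiple of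
  \<open>1 / min p (1 - p)\<close> (lemma \<open>quantile_density_lower_bound\<close>), and the Cauchy-Schwarz inequality
  shows that \<open>Y - X\<close> is constant on \<open>[\<eta>, 1 - \<eta>]\<close> up to an error of order \<open>sqrt (\<epsilon> / \<eta>)\<close> relative to
  the scale of the densities (lemma \<open>quantiles_close\<close>).

  Let \<open>c\<close> be the difference of the medians. At corresponding quantiles the values of \<open>f\<close> and \<open>g\<close> are
  compared by means of the deficit, and moving the argument of the unimodal function \<open>g\<close> by a small
  distance \<open>d\<close> changes it by at most \<open>2 * d * peak g\<close> in the mean. This bounds the \<open>L\<^sup>1\<close> distance of
  \<open>f\<close> and \<open>g (\<cdot> + c)\<close> by a multiple of \<open>\<eta> + sqrt \<epsilon> + sqrt (\<epsilon> / \<eta>)\<close> (lemma \<open>excess_le\<close>), which is of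
  order \<open>root 3 \<epsilon>\<close> for \<open>\<eta> = root 3 \<epsilon>\<close>. Since \<open>m (\<cdot> + c / 2)\<close> lies above the minimum of \<open>f\<close> and
  \<open>g (\<cdot> + c)\<close> and has almost the same integral, it is close to both.

  In general \<open>f\<close> and \<open>g\<close> are replaced by the largest functions that still satisfy the hypothesis
  against \<open>m\<close>. These are log-concave because \<open>m\<close> is, and by the inequality itself their
  masses are larger only by a factor \<open>1 + O(\<epsilon>)\<close>.
\<close>

section \<open>Log-concave functions on the line\<close>

lemma log_concave_nonneg: "log_concave h \<Longrightarrow> 0 \<le> h x"
  by (simp add: log_concave_def)

lemma log_concaveD:
  "log_concave h \<Longrightarrow> 0 < l \<Longrightarrow> l < 1 \<Longrightarrow>
    h x powr (1 - l) * h y powr l \<le> h ((1 - l) * x + l * y)"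
  by (simp add: log_concave_def)

lemma powr_one_minus_mult_powr: "0 \<le> (a::real) \<Longrightarrow> a powr (1 - l) * a powr l = a"
  by (cases "a = 0") (simp_all add: powr_add[symmetric])

lemma between_convex_comb:
  fixes x y z :: real
  assumes "x < z" "z < y"
  defines "l \<equiv> (z - x) / (y - x)"
  shows "0 < l" "l < 1" "z = (1 - l) * x + l * y"
proof -
  show "0 < l" "l < 1" using assms by (auto simp: field_simps)
  have "l * (y - x) = z - x" using assms by simp
  then show "z = (1 - l) * x + l * y" by (simp add: algebra_simps)
qed

lemma log_concave_min_le:
  assumes h: "log_concave h" and "x \<le> z" "z \<le> y"
  shows "min (h x) (h y) \<le> h z"
proof (cases "z = x \<or> z = y")
  case False
  define l where "l = (z - x) / (y - x)"
  have l: "0 < l" "l < 1" "z = (1 - l) * x + l * y"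
    using between_convex_comb[of x z y] False assms unfolding l_def by auto
  define k where "k = min (h x) (h y)"
  have k: "0 \<le> k" "k \<le> h x" "k \<le> h y"
    using log_concave_nonneg[OF h] by (auto simp: k_def)
  have "k = k powr (1 - l) * k powr l" using powr_one_minus_mult_powr k by simp
  also have "\<dots> \<le> h x powr (1 - l) * h y powr l"
    using k l by (intro mult_mono powr_mono2) auto
  also have "\<dots> \<le> h z" using log_concaveD[OF h l(1,2)] l(3) by simp
  finally show ?thesis by (simp add: k_def)
qed auto

lemma log_concave_pos_between:
  assumes "log_concave h" "0 < h x" "0 < h y" "x \<le> z" "z \<le> y"
  shows "0 < h z"
  using log_concave_min_le[OF assms(1,4,5)] assms(2,3) by linarith

text \<open>Log-concavity in four-point form: of two pairs of points with the same midpoint, the one with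
  the smaller spread has the larger product of values.\<close>

lemma log_concave_shift_mult:
  assumes h: "log_concave h" and u: "0 \<le> u" and xy: "x \<le> y"
  shows "h (x - u) * h y \<le> h x * h (y - u)"
proof (cases "u = 0 \<or> x = y")
  case False
  define l where "l = (x - (x - u)) / (y - (x - u))"
  have l: "0 < l" "l < 1" "x = (1 - l) * (x - u) + l * y"
    using between_convex_comb[of "x - u" x y] False assms unfolding l_def by auto
  have l2: "y - u = (1 - (1 - l)) * (x - u) + (1 - l) * y"
    using l(3) by (simp add: algebra_simps)
  have "h (x - u) * h y = (h (x - u) powr (1 - l) * h (x - u) powr l) * (h y powr (1 - l) * h y powr l)"
    using powr_one_minus_mult_powr log_concave_nonneg[OF h] by simp
  also have "\<dots> = (h (x - u) powr (1 - l) * h y powr l) * (h (x - u) powr (1 - (1 - l)) * h y powr (1 - l))"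
    by (simp add: algebra_simps)
  also have "\<dots> \<le> h x * h (y - u)"
  proof (rule mult_mono)
    show "h (x - u) powr (1 - l) * h y powr l \<le> h x"
      using log_concaveD[OF h l(1,2), of "x - u" y] l(3) by simp
    have *: "0 < 1 - l" "1 - l < 1" using l by auto
    show "h (x - u) powr (1 - (1 - l)) * h y powr (1 - l) \<le> h (y - u)"
      using log_concaveD[OF h *, of "x - u" y] by (subst l2)
  qed (use log_concave_nonneg[OF h] in auto)
  finally show ?thesis .
qed auto

lemma log_concave_continuous_on:
  assumes h: "log_concave h" and y: "0 < h y" and z: "0 < h z"
  shows "continuous_on {y<..<z} h"
proof -
  have pos: "0 < h x" if "x \<in> {y<..<z}" for x
    using log_concave_pos_between[OF h y z, of x] that by auto
  have "convex_on {y<..<z} (\<lambda>x. - ln (h x))"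
  proof (rule convex_onI)
    fix t a b :: real assume t: "0 < t" "t < 1" and ab: "a \<in> {y<..<z}" "b \<in> {y<..<z}"
    have c: "(1 - t) * a + t * b \<in> {y<..<z}"
      using convexD_alt[of "{y<..<z}" a b t] ab t by (auto simp: convex_real_interval)
    have "(1 - t) * ln (h a) + t * ln (h b) = ln (h a powr (1 - t) * h b powr t)"
      using pos[OF ab(1)] pos[OF ab(2)] by (simp add: ln_mult_pos ln_powr)
    also have "\<dots> \<le> ln (h ((1 - t) * a + t * b))"
      using log_concaveD[OF h t] pos[OF c] pos[OF ab(1)] pos[OF ab(2)]
      by (intro ln_mono) simp_all
    finally show "- ln (h ((1 - t) *\<^sub>R a + t *\<^sub>R b)) \<le> (1 - t) * - ln (h a) + t * - ln (h b)"
      by simp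
  qed (auto simp: convex_real_interval)
  then have "continuous_on {y<..<z} (\<lambda>x. - ln (h x))"
    by (intro convex_on_continuous) auto
  then have "continuous_on {y<..<z} (\<lambda>x. exp (- (- ln (h x))))"
    by (rule continuous_on_exp[OF continuous_on_minus])
  then show ?thesis
    by (rule continuous_on_eq) (use pos in auto)
qed

lemma log_concave_borel_measurable:
  assumes h: "log_concave h"
  shows "h \<in> borel_measurable borel"
proof (rule borel_measurableI_ge)
  fix c
  have "is_interval {x. c \<le> h x}"
    unfolding is_interval_1
  proof clarsimp
    fix a b x assume "c \<le> h a" "c \<le> h b" "a \<le> x" "x \<le> b"
    then show "c \<le> h x" using log_concave_min_le[OF h, of a x b] by linarith
  qed
  then show "{x \<in> space borel. c \<le> h x} \<in> sets borel"
    using real_interval_borel_measurable by simp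
qed

section \<open>Distribution and quantile functions of a log-concave density\<close>

text \<open>The distribution function of the density \<open>f\<close>.\<close>

definition mass_below :: "(real \<Rightarrow> real) \<Rightarrow> real \<Rightarrow> real" where
  "mass_below f x = (\<integral>t. indicator {..x} t * f t \<partial>lborel)"

text \<open>The inverse of the distribution function. For a log-concave probability density the inverse is
  unique at every level \<open>p\<close> with \<open>0 < p < 1\<close>; at other levels the value is immaterial.\<close>

definition quantile :: "(real \<Rightarrow> real) \<Rightarrow> real \<Rightarrow> real" where
  "quantile f p = (SOME x. mass_below f x = p)"

text \<open>The supremum of \<open>f\<close>. It need not be attained, because a log-concave function
  may drop at an end point of its support.\<close>

definition peak :: "(real \<Rightarrow> real) \<Rightarrow> real" where
  "peak f = (SUP x. f x)"

text \<open>Log-concave probability densities on the line, with respect to Lebesgue measure.\<close>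

locale log_concave_density =
  fixes f :: "real \<Rightarrow> real"
  assumes log_concave: "log_concave f"
    and integrable: "integrable lborel f"
    and total_mass: "(\<integral>x. f x \<partial>lborel) = 1"
begin

lemma nonneg: "0 \<le> f x"
  using log_concave_nonneg[OF log_concave] .

lemma meas [measurable]: "f \<in> borel_measurable borel"
  using log_concave_borel_measurable[OF log_concave] .

lemma integrable_indicator: "A \<in> sets borel \<Longrightarrow> integrable lborel (\<lambda>t. indicator A t * f t)"
  using integrable_mult_indicator[OF _ integrable, of A] by simp

lemma mass_below_nonneg: "0 \<le> mass_below f x"
  unfolding mass_below_def by (intro integral_nonneg_AE) (auto simp: nonneg)

lemma mass_above: "1 - mass_below f x = (\<integral>t. indicator {x<..} t * f t \<partial>lborel)"
proof -
  have "1 - mass_below f x = (\<integral>t. f t - indicator {..x} t * f t \<partial>lborel)"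
    unfolding mass_below_def total_mass[symmetric]
    by (rule Bochner_Integration.integral_diff[symmetric]) (auto intro: integrable integrable_indicator)
  also have "\<dots> = (\<integral>t. indicator {x<..} t * f t \<partial>lborel)"
    by (intro Bochner_Integration.integral_cong) (auto simp: indicator_def)
  finally show ?thesis .
qed

lemma mass_below_le_1: "mass_below f x \<le> 1"
proof -
  have "0 \<le> 1 - mass_below f x"
    unfolding mass_above by (intro integral_nonneg_AE) (auto simp: nonneg)
  then show ?thesis by simp
qed

lemma integrable_on_interval: "f integrable_on {a..b}"
  using integrable_on_lborel[OF integrable] by (rule integrable_on_subinterval) auto

lemma mass_below_diff:
  assumes "x \<le> y"
  shows "mass_below f y = mass_below f x + integral {x..y} f"
proof -
  have "mass_below f y - mass_below f x = (\<integral>t. indicator {..y} t * f t - indicator {..x} t * f t \<partial>lborel)"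
    unfolding mass_below_def by (rule Bochner_Integration.integral_diff[symmetric]) (auto intro: integrable_indicator)
  also have "\<dots> = (\<integral>t. indicator {x..y} t * f t \<partial>lborel)"
  proof (rule integral_cong_AE)
    show "AE t in lborel. indicator {..y} t * f t - indicator {..x} t * f t = indicator {x..y} t * f t"
      using AE_lborel_singleton[of x] by eventually_elim (use assms in \<open>auto simp: indicator_def\<close>)
  qed simp_all
  also have "\<dots> = (LINT t:{x..y}|lborel. f t)"
    by (simp add: set_lebesgue_integral_def)
  also have "\<dots> = integral {x..y} f"
    using integrable_indicator[of "{x..y}"]
    by (intro set_borel_integral_eq_integral) (simp add: set_integrable_def)
  finally show ?thesis by simp
qed

lemma mass_below_mono: "x \<le> y \<Longrightarrow> mass_below f x \<le> mass_below f y"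
  using mass_below_diff[of x y] integral_nonneg[OF integrable_on_interval, of x y] nonneg by simp

lemma continuous_mass_below: "continuous_on A (mass_below f)"
proof -
  have "isCont (mass_below f) x" for x
  proof -
    have "continuous_on {x - 1..x + 1} (\<lambda>y. mass_below f (x - 1) + integral {x - 1..y} f)"
      by (intro continuous_intros indefinite_integral_continuous_1 integrable_on_interval)
    then have "continuous_on {x - 1..x + 1} (mass_below f)"
      by (rule continuous_on_eq) (metis mass_below_diff atLeastAtMost_iff)
    then have "continuous_on {x - 1<..<x + 1} (mass_below f)"
      by (rule continuous_on_subset) auto
    then show ?thesis
      by (simp add: continuous_on_eq_continuous_at)
  qed
  then show ?thesis by (simp add: continuous_at_imp_continuous_on)
qed

lemma mass_below_tail: 
  assumes "0 < p" shows "\<exists>x. mass_below f x < p" "\<exists>x. 1 - p < mass_below f x"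
proof -
  have "(\<lambda>n. \<integral>t. indicator {..- real n} t * f t \<partial>lborel) \<longlonglongrightarrow> (\<integral>t. 0 \<partial>(lborel :: real measure))"
  proof (rule integral_dominated_convergence[where w = f])
    show "AE t in lborel. (\<lambda>n. indicator {..- real n} t * f t) \<longlonglongrightarrow> 0"
    proof (intro AE_I2 tendsto_eventually)
      fix t :: real
      obtain N where N: "- t < real N" using reals_Archimedean2 by blast
      show "\<forall>\<^sub>F n in sequentially. indicator {..- real n} t * f t = 0"
        using eventually_ge_at_top[of N] by eventually_elim (use N in \<open>auto simp: indicator_def\<close>)
    qed
  qed (auto simp: integrable nonneg indicator_def)
  then have "(\<lambda>n. mass_below f (- real n)) \<longlonglongrightarrow> 0" by (simp add: mass_below_def)
  from order_tendstoD(2)[OF this assms] show "\<exists>x. mass_below f x < p"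
    by (auto dest: eventually_happens)
  have "((\<lambda>y. mass_below f y) \<longlongrightarrow> 1) at_top"
    using tendsto_integral_at_top[of lborel f] integrable total_mass by (simp add: mass_below_def)
  from order_tendstoD(1)[OF this, of "1 - p"] assms show "\<exists>x. 1 - p < mass_below f x"
    by (auto dest: eventually_happens)
qed

lemma mass_below_surj:
  assumes "0 < p" "p < 1"
  shows "\<exists>x. mass_below f x = p"
proof -
  obtain a b where ab: "mass_below f a < p" "p < mass_below f b"
    using mass_below_tail(1)[OF assms(1)] mass_below_tail(2)[of "1 - p"] assms by auto
  have "a \<le> b"
  proof (rule ccontr)
    assume "\<not> a \<le> b" then show False using mass_below_mono[of b a] ab by simp
  qed
  then show ?thesis
    using IVT'[of "mass_below f" a p b] ab continuous_mass_below by auto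
qed

lemma mass_below_quantile: "0 < p \<Longrightarrow> p < 1 \<Longrightarrow> mass_below f (quantile f p) = p"
  unfolding quantile_def using mass_below_surj by (rule someI_ex)

text \<open>The points with positive mass on both sides, that is, the interior of the support. There the
  density is positive and continuous, and the distribution function is a \<open>C\<^sup>1\<close> bijection onto the
  open unit interval.\<close>

definition bulk :: "real set" where
  "bulk = {x. 0 < mass_below f x \<and> mass_below f x < 1}"

lemma quantile_in_bulk: "0 < p \<Longrightarrow> p < 1 \<Longrightarrow> quantile f p \<in> bulk"
  by (simp add: bulk_def mass_below_quantile)

lemma open_bulk: "open bulk"
proof -
  have "bulk = mass_below f -` {0<..<1}" by (auto simp: bulk_def)
  then show ?thesis
    using continuous_open_vimage[of "{0<..<1}" "mass_below f"] continuous_mass_below[of UNIV]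
    by (simp add: continuous_on_eq_continuous_at)
qed

lemma bulk_surrounded:
  assumes "x \<in> bulk"
  obtains y z where "y < x" "x < z" "0 < f y" "0 < f z"
proof -
  have "\<exists>y<x. 0 < f y"
  proof (rule ccontr)
    assume "\<not> (\<exists>y<x. 0 < f y)"
    then have z: "f y = 0" if "y < x" for y using nonneg[of y] that by force
    have "mass_below f x = (\<integral>t. 0 \<partial>(lborel :: real measure))"
      unfolding mass_below_def
    proof (rule integral_cong_AE)
      show "AE t in lborel. indicator {..x} t * f t = 0"
        using AE_lborel_singleton[of x] by eventually_elim (auto simp: indicator_def z)
    qed simp_all
    then show False using assms by (simp add: bulk_def)
  qed
  moreover have "\<exists>z>x. 0 < f z"
  proof (rule ccontr)
    assume "\<not> (\<exists>z>x. 0 < f z)"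
    then have z: "f y = 0" if "x < y" for y using nonneg[of y] that by force
    have "1 - mass_below f x = (\<integral>t. 0 \<partial>(lborel :: real measure))"
      unfolding mass_above by (intro Bochner_Integration.integral_cong) (auto simp: indicator_def z)
    then show False using assms by (simp add: bulk_def)
  qed
  ultimately show ?thesis using that by blast
qed

lemma pos_bulk: "x \<in> bulk \<Longrightarrow> 0 < f x"
  by (meson bulk_surrounded log_concave_pos_between[OF log_concave] less_imp_le)

lemma isCont_bulk: assumes "x \<in> bulk" shows "isCont f x"
proof -
  obtain y z where yz: "y < x" "x < z" "0 < f y" "0 < f z" using bulk_surrounded[OF assms] .
  have "continuous_on {y<..<z} f"
    using log_concave_continuous_on[OF log_concave yz(3,4)] .
  then show ?thesis
    using yz(1,2) by (simp add: continuous_on_eq_continuous_at)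
qed

lemma DERIV_mass_below:
  assumes x: "x \<in> bulk"
  shows "(mass_below f has_real_derivative f x) (at x)"
proof -
  have "((\<lambda>u. integral {x - 1..u} f) has_vector_derivative f x) (at x within ({x - 1..x + 1} - {}))"
    by (rule integral_has_vector_derivative_continuous_at[OF integrable_on_interval])
      (auto intro: continuous_at_imp_continuous_at_within isCont_bulk[OF x])
  then have "((\<lambda>u. integral {x - 1..u} f) has_real_derivative f x) (at x within {x - 1..x + 1})"
    by (simp add: has_real_derivative_iff_has_vector_derivative)
  then have "((\<lambda>u. integral {x - 1..u} f) has_real_derivative f x) (at x)"
    using at_within_interior[of x "{x - 1..x + 1}"] by (simp add: interior_atLeastAtMost_real)
  then have "((\<lambda>u. mass_below f (x - 1) + integral {x - 1..u} f) has_real_derivative f x) (at x)"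
    by (auto intro!: derivative_eq_intros)
  moreover have "\<forall>\<^sub>F u in nhds x. mass_below f (x - 1) + integral {x - 1..u} f = mass_below f u"
  proof -
    have "\<forall>\<^sub>F u in nhds x. u \<in> {x - 1<..}" by (rule eventually_nhds_in_open) auto
    then show ?thesis by eventually_elim (metis mass_below_diff greaterThan_iff less_imp_le)
  qed
  ultimately show ?thesis by (subst (asm) DERIV_cong_ev[OF refl _ refl]) auto
qed

lemma bulk_between: "x \<in> bulk \<Longrightarrow> y \<in> bulk \<Longrightarrow> x \<le> z \<Longrightarrow> z \<le> y \<Longrightarrow> z \<in> bulk"
  unfolding bulk_def using mass_below_mono[of x z] mass_below_mono[of z y] by auto

lemma mass_below_strict_mono:
  assumes "x \<in> bulk" "y \<in> bulk" "x < y"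
  shows "mass_below f x < mass_below f y"
proof (rule DERIV_pos_imp_increasing[OF \<open>x < y\<close>])
  fix z assume "x \<le> z" "z \<le> y"
  then have "z \<in> bulk" using bulk_between assms by blast
  then show "\<exists>D. (mass_below f has_real_derivative D) (at z) \<and> 0 < D"
    using DERIV_mass_below pos_bulk by blast
qed

lemma quantile_mass_below:
  assumes "x \<in> bulk"
  shows "quantile f (mass_below f x) = x"
proof -
  have p: "0 < mass_below f x" "mass_below f x < 1" using assms by (auto simp: bulk_def)
  show ?thesis
    using mass_below_strict_mono[OF assms quantile_in_bulk[OF p]]
      mass_below_strict_mono[OF quantile_in_bulk[OF p] assms] mass_below_quantile[OF p]
    by (cases "quantile f (mass_below f x)" x rule: linorder_cases) auto
qed

lemma DERIV_quantile:
  assumes p: "0 < p" "p < 1"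
  shows "(quantile f has_real_derivative 1 / f (quantile f p)) (at p)"
  unfolding has_field_derivative_def
proof (rule has_derivative_inverse_strong_x[of bulk "quantile f" p "mass_below f"])
  show "(mass_below f has_derivative (*) (f (quantile f p))) (at (quantile f p))"
    using DERIV_mass_below[OF quantile_in_bulk[OF p]] by (simp add: has_field_derivative_def)
  show "(*) (f (quantile f p)) \<circ> (*) (1 / f (quantile f p)) = id"
    using pos_bulk[OF quantile_in_bulk[OF p]] by (auto simp: fun_eq_iff)
qed (auto simp: open_bulk quantile_in_bulk p continuous_mass_below quantile_mass_below mass_below_quantile)

lemma isCont_quantile: "0 < p \<Longrightarrow> p < 1 \<Longrightarrow> isCont (quantile f) p"
  using DERIV_quantile DERIV_isCont by blast

lemma quantile_mono:
  assumes "0 < p" "p \<le> q" "q < 1"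
  shows "quantile f p \<le> quantile f q"
proof (rule ccontr)
  assume "\<not> ?thesis"
  then have "mass_below f (quantile f q) < mass_below f (quantile f p)"
    using assms by (intro mass_below_strict_mono quantile_in_bulk) auto
  then show False using assms by (simp add: mass_below_quantile)
qed

text \<open>The quantitative use of log-concavity: as a function of \<open>p\<close>, the density at the
  \<open>p\<close>-quantile is at least the peak times \<open>min p (1 - p)\<close>. The four-point inequality
  \<open>f t * f y \<le> f x * f (t + (y - x))\<close>, integrated over the \<open>t\<close> that lie on the far side of \<open>x\<close>
  from \<open>y\<close>, gives it.\<close>

lemma density_lower_bound: "f y * min (mass_below f x) (1 - mass_below f x) \<le> f x"
proof (cases "x \<le> y")
  case True
  have "f y * mass_below f x = (\<integral>t. f y * (indicator {..x} t * f t) \<partial>lborel)"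
    by (simp add: mass_below_def)
  also have "\<dots> \<le> (\<integral>t. f x * f ((y - x) + 1 * t) \<partial>lborel)"
  proof (rule integral_mono)
    show "integrable lborel (\<lambda>t. f x * f ((y - x) + 1 * t))"
      by (intro integrable_mult_right lborel_integrable_real_affine integrable) simp
    fix t
    show "f y * (indicator {..x} t * f t) \<le> f x * f ((y - x) + 1 * t)"
      using log_concave_shift_mult[OF log_concave, of "x - t" x y] True
      by (auto simp: indicator_def nonneg algebra_simps)
  qed (intro integrable_mult_right integrable_indicator, simp)
  also have "\<dots> = f x"
    using lborel_integral_real_affine[of 1 f "y - x"] total_mass by simp
  finally have "f y * mass_below f x \<le> f x" .
  then show ?thesis
    using mult_left_mono[OF min.cobounded1 nonneg[of y], of "mass_below f x" "1 - mass_below f x"] by linarith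
next
  case False
  have "f y * (1 - mass_below f x) = (\<integral>t. f y * (indicator {x<..} t * f t) \<partial>lborel)"
    by (simp add: mass_above)
  also have "\<dots> \<le> (\<integral>t. f x * f ((y - x) + 1 * t) \<partial>lborel)"
  proof (rule integral_mono)
    show "integrable lborel (\<lambda>t. f x * f ((y - x) + 1 * t))"
      by (intro integrable_mult_right lborel_integrable_real_affine integrable) simp
    fix t
    show "f y * (indicator {x<..} t * f t) \<le> f x * f ((y - x) + 1 * t)"
      using log_concave_shift_mult[OF log_concave, of "x - y" x t] False
      by (auto simp: indicator_def nonneg algebra_simps)
  qed (intro integrable_mult_right integrable_indicator, simp)
  also have "\<dots> = f x"
    using lborel_integral_real_affine[of 1 f "y - x"] total_mass by simp
  finally have "f y * (1 - mass_below f x) \<le> f x" .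
  then show ?thesis
    using mult_left_mono[OF min.cobounded2 nonneg[of y], of "mass_below f x" "1 - mass_below f x"] by linarith
qed

lemma bdd_above: "bdd_above (range f)"
proof (rule bdd_aboveI2)
  fix y show "f y \<le> 2 * f (quantile f (1/2))"
    using density_lower_bound[of y "quantile f (1/2)"] by (simp add: mass_below_quantile)
qed

lemma le_peak: "f x \<le> peak f"
  unfolding peak_def by (intro cSUP_upper bdd_above) simp

lemma peak_pos: "0 < peak f"
  using le_peak[of "quantile f (1/2)"] pos_bulk[OF quantile_in_bulk[of "1/2"]] by simp

lemma quantile_density_lower_bound:
  assumes p: "0 < p" "p < 1"
  shows "peak f * min p (1 - p) \<le> f (quantile f p)"
proof -
  have m: "0 < min p (1 - p)" using p by simp
  have "peak f \<le> f (quantile f p) / min p (1 - p)"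
    unfolding peak_def
  proof (rule cSUP_least)
    fix y show "f y \<le> f (quantile f p) / min p (1 - p)"
      using density_lower_bound[of y "quantile f p"] m p by (simp add: mass_below_quantile pos_le_divide_eq)
  qed simp
  then show ?thesis using m by (simp add: pos_le_divide_eq)
qed

lemma plateau_le:
  assumes "a \<le> b" "\<And>x. a \<le> x \<Longrightarrow> x \<le> b \<Longrightarrow> k \<le> f x"
  shows "k * (b - a) \<le> 1"
proof -
  have "k * (b - a) = integral {a..b} (\<lambda>x. k)" using assms(1) by simp
  also have "\<dots> \<le> integral {a..b} f"
    using assms by (intro integral_le integrable_on_interval) auto
  also have "\<dots> \<le> 1"
    using mass_below_diff[OF assms(1)] mass_below_nonneg[of a] mass_below_le_1[of b] by simp
  finally show ?thesis .
qed

text \<open>The mode \<open>\<mu>\<close> separates the set \<open>N\<close> of points that have a point of strictly larger density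
  to their right from its complement; integrability keeps \<open>N\<close> from being empty or unbounded.\<close>

lemma unimodal:
  obtains \<mu> where "\<And>x y. x \<le> y \<Longrightarrow> y < \<mu> \<Longrightarrow> f x \<le> f y"
    and "\<And>x y. \<mu> < x \<Longrightarrow> x \<le> y \<Longrightarrow> f y \<le> f x"
proof -
  define N where "N = {x. \<exists>y>x. f x < f y}"
  define z where "z = quantile f (1/2)"
  have z: "0 < f z" using pos_bulk[OF quantile_in_bulk[of "1/2"]] by (simp add: z_def)
  define L where "L = 2 / f z"
  have L: "0 < L" "f z * L > 1" using z by (auto simp: L_def)
  have incr: "f x \<le> f y" if xy: "x \<le> y" and y: "y \<in> N" for x y
  proof -
    obtain w where "w > y" "f y < f w" using y by (auto simp: N_def)
    then show ?thesis using log_concave_min_le[OF log_concave xy, of w] by auto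
  qed
  have down: "x \<in> N" if xy: "x \<le> y" and y: "y \<in> N" for x y
  proof -
    obtain w where w: "w > y" "f y < f w" using y by (auto simp: N_def)
    moreover have "f x \<le> f y" using incr[OF xy y] .
    ultimately have "w > x" "f x < f w" using xy by auto
    then show ?thesis by (auto simp: N_def)
  qed
  have decr: "f y \<le> f x" if "x \<le> y" "x \<notin> N" for x y
    using that by (cases "x = y") (force simp: N_def not_less)+
  have "N \<noteq> {}"
  proof (rule ccontr)
    assume "\<not> ?thesis"
    then have "f z * (z - (z - L)) \<le> 1"
      using L by (intro plateau_le) (auto intro: decr)
    then show False using L by simp
  qed
  have top: "z + L \<notin> N"
  proof
    assume "z + L \<in> N"
    then have "f z * (z + L - z) \<le> 1"
      using L by (intro plateau_le) (auto intro: incr down)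
    then show False using L by simp
  qed
  have "x \<le> z + L" if "x \<in> N" for x
    using down[of "z + L" x] that top by linarith
  then have "bdd_above N" by (rule bdd_aboveI)
  with \<open>N \<noteq> {}\<close> have N: "N \<noteq> {}" "bdd_above N" by auto
  show ?thesis
  proof (rule that[of "Sup N"])
    fix x y :: real assume xy: "x \<le> y" "y < Sup N"
    obtain w where "w \<in> N" "y < w" using less_cSupD[OF N(1) xy(2)] by blast
    then show "f x \<le> f y" using incr[OF xy(1)] down[of y w] by simp
  next
    fix x y :: real assume xy: "Sup N < x" "x \<le> y"
    then have "x \<notin> N" using cSup_upper[OF _ N(2), of x] by auto
    then show "f y \<le> f x" using decr xy by simp
  qed
qed

text \<open>Replacing a unimodal density by its maximum over a sliding window of radius \<open>d\<close> moves its two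
  monotone branches apart by \<open>2 * d\<close> and fills the gap with the peak, so the integral grows by
  at most \<open>2 * d * peak f\<close>.\<close>

lemma sliding_maximum:
  assumes d: "0 \<le> d"
  obtains k where "integrable lborel k" "\<And>x y. \<bar>y - x\<bar> \<le> d \<Longrightarrow> f y \<le> k x"
    "(\<integral>x. k x \<partial>lborel) \<le> 1 + 2 * d * peak f"
proof -
  obtain \<mu> where inc: "\<And>x y. x \<le> y \<Longrightarrow> y < \<mu> \<Longrightarrow> f x \<le> f y"
    and dec: "\<And>x y. \<mu> < x \<Longrightarrow> x \<le> y \<Longrightarrow> f y \<le> f x" using unimodal by blast
  define l where "l t = indicator {..<\<mu>} t * f t" for t
  define r where "r t = indicator {\<mu><..} t * f t" for t
  have lr: "integrable lborel l" "integrable lborel r"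
    unfolding l_def r_def by (intro integrable_indicator; simp)+
  \<comment> \<open>The factor \<open>1\<close> matches the affine substitution rule for the Lebesgue integral.\<close>
  define k where "k x = l (d + 1 * x) + indicator {\<mu> - d..\<mu> + d} x * peak f + r (- d + 1 * x)" for x
  have shift: "integrable lborel (\<lambda>x. l (d + 1 * x))" "integrable lborel (\<lambda>x. r (- d + 1 * x))"
    by (intro lborel_integrable_real_affine lr; simp)+
  have box: "integrable lborel (\<lambda>x. indicator {\<mu> - d..\<mu> + d} x * peak f)"
    using d by (intro integrable_mult_left integrable_real_indicator) auto
  show ?thesis
  proof
    show "integrable lborel k"
      unfolding k_def using shift box by (intro Bochner_Integration.integrable_add)
    show "f y \<le> k x" if xy: "\<bar>y - x\<bar> \<le> d" for x y
    proof -
      have nn: "0 \<le> l t" "0 \<le> r t" for t by (auto simp: l_def r_def nonneg)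
      consider "x < \<mu> - d" | "\<mu> - d \<le> x" "x \<le> \<mu> + d" | "\<mu> + d < x" by linarith
      then show ?thesis
      proof cases
        case 1
        then have "f y \<le> l (d + 1 * x)" using inc[of y "d + x"] xy by (auto simp: l_def)
        then show ?thesis using nn(2)[of "-d + 1 * x"] 1 by (simp add: k_def)
      next
        case 2
        then show ?thesis using nn(1)[of "d + 1 * x"] nn(2)[of "-d + 1 * x"] le_peak[of y] by (simp add: k_def)
      next
        case 3
        then have "f y \<le> r (- d + 1 * x)" using dec[of "x - d" y] xy by (auto simp: r_def)
        then show ?thesis using nn(1)[of "d + 1 * x"] 3 by (simp add: k_def)
      qed
    qed
    have "(\<integral>x. k x \<partial>lborel) = (\<integral>x. l (d + 1 * x) \<partial>lborel)
        + (\<integral>x. indicator {\<mu> - d..\<mu> + d} x * peak f \<partial>lborel) + (\<integral>x. r (- d + 1 * x) \<partial>lborel)"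
      unfolding k_def by (simp only: shift box Bochner_Integration.integral_add Bochner_Integration.integrable_add)
    also have "(\<integral>x. l (d + 1 * x) \<partial>lborel) = (\<integral>x. l x \<partial>lborel)"
      using lborel_integral_real_affine[of 1 l d] by simp
    also have "(\<integral>x. r (- d + 1 * x) \<partial>lborel) = (\<integral>x. r x \<partial>lborel)"
      using lborel_integral_real_affine[of 1 r "- d"] by simp
    also have "(\<integral>x. indicator {\<mu> - d..\<mu> + d} x * peak f \<partial>lborel) = 2 * d * peak f"
      using d by simp
    also have "(\<integral>x. l x \<partial>lborel) + 2 * d * peak f + (\<integral>x. r x \<partial>lborel)
        = (\<integral>x. l x + r x \<partial>lborel) + 2 * d * peak f"
      using lr by simp
    also have "(\<integral>x. l x + r x \<partial>lborel) \<le> (\<integral>x. f x \<partial>lborel)"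
      by (intro integral_mono Bochner_Integration.integrable_add lr integrable)
        (auto simp: l_def r_def indicator_def nonneg)
    finally show "(\<integral>x. k x \<partial>lborel) \<le> 1 + 2 * d * peak f" using total_mass by simp
  qed
qed

end

section \<open>The deficit in the transport proof\<close>

lemma deficit_eq:
  fixes a b :: real
  assumes "0 < a" "0 < b"
  shows "(1 / a + 1 / b) / 2 * sqrt (a * b) - 1 = (sqrt a - sqrt b)\<^sup>2 / (2 * (sqrt a * sqrt b))"
proof -
  define s t where "s = sqrt a" and "t = sqrt b"
  have st: "0 < s" "0 < t" "sqrt (a * b) = s * t" "a = s * s" "b = t * t"
    using assms by (auto simp: s_def t_def real_sqrt_mult)
  have "(1 / (s * s) + 1 / (t * t)) / 2 * (s * t) - 1 = (s - t)\<^sup>2 / (2 * (s * t))"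
    using st(1,2) by (simp add: field_simps power2_eq_square)
  then show ?thesis unfolding s_def[symmetric] t_def[symmetric] st(3) st(4,5)[symmetric] .
qed

text \<open>In the application \<open>1 / a\<close> and \<open>1 / b\<close> are the derivatives of the two quantile functions. The
  free parameter \<open>\<kappa>\<close> replaces the Cauchy-Schwarz inequality: optimising over it after integration
  gives the same bound.\<close>

lemma inverse_diff_le_deficit:
  fixes a b k \<kappa> :: real
  assumes k: "0 < k" "k \<le> a" "k \<le> b" and \<kappa>: "0 < \<kappa>"
  shows "\<bar>1 / b - 1 / a\<bar> \<le> \<kappa> * ((1 / a + 1 / b) / 2 * sqrt (a * b) - 1) + 2 / (\<kappa> * k\<^sup>2)"
proof -
  define s t where "s = sqrt a" and "t = sqrt b"
  have st: "0 < s" "0 < t" "a = s\<^sup>2" "b = t\<^sup>2" "sqrt (a * b) = s * t"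
    using assms by (auto simp: s_def t_def real_sqrt_mult)
  define u where "u = s * t"
  define q where "q = (s\<^sup>2 + t\<^sup>2) / u\<^sup>2"
  have u: "0 < u" using st by (simp add: u_def)
  have D: "(1 / a + 1 / b) / 2 * sqrt (a * b) - 1 = (s - t)\<^sup>2 / (2 * u)"
    unfolding u_def s_def t_def using assms by (intro deficit_eq) auto
  have gap: "\<bar>1 / b - 1 / a\<bar> = \<bar>s - t\<bar> * (s + t) / u\<^sup>2"
  proof -
    have "1 / b - 1 / a = (s - t) * (s + t) / u\<^sup>2"
      unfolding st u_def using st(1,2) by (simp add: field_simps power2_eq_square)
    then show ?thesis using st by (simp add: abs_mult)
  qed
  have ku: "k \<le> u"
  proof -
    have "k = sqrt (k * k)" using k by simp
    also have "\<dots> \<le> sqrt (a * b)" using k by (intro real_sqrt_le_mono mult_mono) auto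
    finally show ?thesis using st by (simp add: u_def)
  qed
  have q: "q / u \<le> 2 / k\<^sup>2"
  proof -
    have "q = 1 / a + 1 / b" unfolding q_def u_def st using st(1,2) by (simp add: field_simps power2_eq_square)
    also have "\<dots> \<le> 1 / k + 1 / k" using k by (intro add_mono divide_left_mono) auto
    finally have "q \<le> 2 / k" by simp
    then have "q / u \<le> 2 / k / k" using ku k u by (intro frac_le) auto
    then show ?thesis by (simp add: power2_eq_square)
  qed
  define x y v where "x = \<bar>s - t\<bar> * (s + t)" and "y = (s - t)\<^sup>2" and "v = s\<^sup>2 + t\<^sup>2"
  have "0 \<le> (\<kappa> * u * \<bar>s - t\<bar> - (s + t))\<^sup>2 + (s - t)\<^sup>2" by simp
  also have "\<dots> = (\<kappa> * u)\<^sup>2 * y + 2 * v - 2 * \<kappa> * u * x"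
  proof -
    have "(\<kappa> * u * \<bar>s - t\<bar> - (s + t))\<^sup>2 = (\<kappa> * u)\<^sup>2 * y + (s + t)\<^sup>2 - 2 * \<kappa> * u * x"
      by (simp add: power2_diff power_mult_distrib x_def y_def)
    moreover have "(s + t)\<^sup>2 + (s - t)\<^sup>2 = 2 * v"
      by (simp add: power2_sum power2_diff v_def)
    ultimately show ?thesis by linarith
  qed
  finally have "0 \<le> ((\<kappa> * u)\<^sup>2 * y + 2 * v - 2 * \<kappa> * u * x) / (2 * \<kappa> * u ^ 3)"
    using u \<kappa> by simp
  also have "\<dots> = \<kappa> * (y / (2 * u)) + v / u\<^sup>2 / u / \<kappa> - x / u\<^sup>2"
  proof -
    have "(\<kappa> * u)\<^sup>2 * y / (2 * \<kappa> * u ^ 3) = \<kappa> * (y / (2 * u))"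
      using u \<kappa> by (simp add: power2_eq_square power3_eq_cube)
    moreover have "2 * v / (2 * \<kappa> * u ^ 3) = v / u\<^sup>2 / u / \<kappa>"
      using u \<kappa> by (simp add: power2_eq_square power3_eq_cube ac_simps)
    moreover have "2 * \<kappa> * u * x / (2 * \<kappa> * u ^ 3) = x / u\<^sup>2"
      using u \<kappa> by (simp add: power2_eq_square power3_eq_cube)
    ultimately show ?thesis by (simp only: add_divide_distrib diff_divide_distrib)
  qed
  finally have "\<bar>s - t\<bar> * (s + t) / u\<^sup>2 \<le> \<kappa> * ((s - t)\<^sup>2 / (2 * u)) + q / u / \<kappa>"
    by (simp add: q_def x_def y_def v_def)
  also have "\<dots> \<le> \<kappa> * ((s - t)\<^sup>2 / (2 * u)) + 2 / k\<^sup>2 / \<kappa>"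
    using q \<kappa> by (intro add_left_mono divide_right_mono) auto
  finally show ?thesis unfolding D gap by (simp add: mult.commute)
qed

text \<open>Again \<open>r\<close> is a free parameter, to be chosen as \<open>sqrt \<epsilon>\<close> when the integral of the deficit is at
  most \<open>\<epsilon>\<close>.\<close>

lemma excess_ratio_le_deficit:
  fixes a b r :: real
  assumes ab: "0 < a" "0 < b" and r: "0 < r"
  shows "max 0 (1 - b / a) \<le> 4 / r * ((1 / a + 1 / b) / 2 * sqrt (a * b) - 1) + r / 2"
proof -
  define s t where "s = sqrt a" and "t = sqrt b"
  have st: "0 < s" "0 < t" "a = s\<^sup>2" "b = t\<^sup>2" "sqrt (a * b) = s * t"
    using assms by (auto simp: s_def t_def real_sqrt_mult)
  have D: "(1 / a + 1 / b) / 2 * sqrt (a * b) - 1 = (s - t)\<^sup>2 / (2 * (s * t))"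
    unfolding s_def t_def by (rule deficit_eq[OF ab])
  show ?thesis
  proof (cases "t < s")
    case False
    then have "1 - b / a \<le> 0" using st by (simp add: power_mono)
    then show ?thesis unfolding D using r st by simp
  next
    case True
    define w where "w = (s - t) / s"
    have w: "0 \<le> w" "t = s * (1 - w)" using True st by (auto simp: w_def field_simps)
    have "1 - b / a = 1 - (1 - w)\<^sup>2" unfolding st(3,4) w(2) using st(1) by (simp add: power_mult_distrib)
    also have "\<dots> \<le> 2 * w" by (simp add: power2_eq_square algebra_simps)
    finally have 1: "max 0 (1 - b / a) \<le> 2 * w" using w by simp
    have "0 \<le> (2 * w - r)\<^sup>2 / (2 * r)" using r by simp
    also have "\<dots> = 2 * w\<^sup>2 / r + r / 2 - 2 * w" using r by (simp add: field_simps power2_eq_square)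
    finally have 2: "2 * w \<le> 4 / r * (w\<^sup>2 / 2) + r / 2" by simp
    have "w\<^sup>2 / 2 = (s - t)\<^sup>2 / (2 * (s * s))" by (simp add: w_def power2_eq_square)
    also have "\<dots> \<le> (s - t)\<^sup>2 / (2 * (s * t))" using True st by (intro divide_left_mono) auto
    finally have "4 / r * (w\<^sup>2 / 2) \<le> 4 / r * ((s - t)\<^sup>2 / (2 * (s * t)))"
      using r by (intro mult_left_mono) auto
    with 1 2 show ?thesis unfolding D by linarith
  qed
qed

text \<open>The hypotheses of the Prekopa-Leindler inequality for two log-concave probability densities.\<close>

locale prekopa_triple = F: log_concave_density f + G: log_concave_density g
  for f g :: "real \<Rightarrow> real" +
  fixes m :: "real \<Rightarrow> real"
  assumes m_log_concave: "log_concave m"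
    and m_integrable: "integrable lborel m"
    and m_ge: "\<And>r s. sqrt (f r * g s) \<le> m ((r + s) / 2)"
begin

lemma swap: "prekopa_triple g f m"
proof -
  interpret H: log_concave_density g by unfold_locales
  show ?thesis
  proof unfold_locales
    fix r s show "sqrt (g r * f s) \<le> m ((r + s) / 2)"
      using m_ge[of s r] by (simp add: mult.commute add.commute)
  qed (rule m_log_concave m_integrable)+
qed

text \<open>The densities as functions of the mass below, \<open>I\<^sub>f\<close> for \<open>f\<close> and \<open>I\<^sub>g\<close> for \<open>g\<close>. The quantile
  functions have derivatives \<open>1 / I\<^sub>f\<close> and \<open>1 / I\<^sub>g\<close>.\<close>

definition I\<^sub>f where "I\<^sub>f p = f (quantile f p)"
definition I\<^sub>g where "I\<^sub>g p = g (quantile g p)"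

text \<open>The midpoint \<open>S p\<close> of the \<open>p\<close>-quantiles of \<open>f\<close> and \<open>g\<close> transports at least mass
  \<open>m (S p) * S' p \<ge> 1 + deficit p\<close> per unit of \<open>p\<close>. By the inequality of arithmetic and geometric
  means the deficit is non-negative, and it vanishes exactly where \<open>I\<^sub>f p = I\<^sub>g p\<close>.\<close>

definition deficit where
  "deficit p = (1 / I\<^sub>f p + 1 / I\<^sub>g p) / 2 * sqrt (I\<^sub>f p * I\<^sub>g p) - 1"

lemma I_pos: "0 < p \<Longrightarrow> p < 1 \<Longrightarrow> 0 < I\<^sub>f p" "0 < p \<Longrightarrow> p < 1 \<Longrightarrow> 0 < I\<^sub>g p"
  by (simp_all add: I\<^sub>f_def I\<^sub>g_def F.pos_bulk F.quantile_in_bulk G.pos_bulk G.quantile_in_bulk)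

lemma continuous_I:
  assumes "0 < a" "b < 1"
  shows "continuous_on {a..b} I\<^sub>f" "continuous_on {a..b} I\<^sub>g"
proof -
  have "isCont I\<^sub>f p" "isCont I\<^sub>g p" if "p \<in> {a..b}" for p
    unfolding I\<^sub>f_def I\<^sub>g_def using that assms
    by (auto intro!: isCont_o2[of p "quantile f" f] isCont_o2[of p "quantile g" g]
        F.isCont_quantile G.isCont_quantile F.isCont_bulk G.isCont_bulk
        F.quantile_in_bulk G.quantile_in_bulk)
  then show "continuous_on {a..b} I\<^sub>f" "continuous_on {a..b} I\<^sub>g"
    by (auto intro: continuous_at_imp_continuous_on)
qed

lemma continuous_deficit:
  assumes "0 < a" "b < 1"
  shows "continuous_on {a..b} deficit"
proof -
  have "I\<^sub>f p \<noteq> 0" "I\<^sub>g p \<noteq> 0" if "p \<in> {a..b}" for p using I_pos[of p] that assms by auto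
  then show ?thesis
    unfolding deficit_def by (intro continuous_intros continuous_I assms) auto
qed

lemma deficit_nonneg: "0 < p \<Longrightarrow> p < 1 \<Longrightarrow> 0 \<le> deficit p"
  unfolding deficit_def using deficit_eq[of "I\<^sub>f p" "I\<^sub>g p"] I_pos[of p] by simp

text \<open>Substitution along the midpoint map \<open>S\<close>, on a compact part of the unit interval so that all
  integrands are continuous.\<close>

lemma integral_deficit_add_mass_le:
  assumes \<eta>: "0 < \<eta>" "\<eta> < 1/2"
  shows "integral {\<eta>..1 - \<eta>} deficit + (1 - 2 * \<eta>) \<le> (\<integral>x. m x \<partial>lborel)"
proof -
  define S where "S p = (quantile f p + quantile g p) / 2" for p
  define S' where "S' p = (1 / I\<^sub>f p + 1 / I\<^sub>g p) / 2" for p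
  have DS: "(S has_real_derivative S' p) (at p)" if "0 < p" "p < 1" for p
    unfolding S_def S'_def I\<^sub>f_def I\<^sub>g_def
    using F.DERIV_quantile[OF that] G.DERIV_quantile[OF that]
    by (auto intro!: derivative_eq_intros)
  have S'_pos: "0 < S' p" if "0 < p" "p < 1" for p
    unfolding S'_def using I_pos[OF that] by (simp add: add_pos_pos)
  have S_less: "S p < S q" if "0 < p" "p < q" "q < 1" for p q
  proof (rule DERIV_pos_imp_increasing[OF that(2)])
    fix x assume "p \<le> x" "x \<le> q"
    then have "0 < x" "x < 1" using that by auto
    then show "\<exists>D. (S has_real_derivative D) (at x) \<and> 0 < D" using DS S'_pos by blast
  qed
  have S_le: "S p \<le> S q" if "0 < p" "p \<le> q" "q < 1" for p q
    using S_less[of p q] that by (cases "p = q") auto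
  have m_S: "sqrt (I\<^sub>f p * I\<^sub>g p) \<le> m (S p)" for p
    unfolding I\<^sub>f_def I\<^sub>g_def S_def by (rule m_ge)
  have m_S_pos: "0 < m (S p)" if "0 < p" "p < 1" for p
    using m_S[of p] I_pos[OF that] by (smt (verit) mult_pos_pos real_sqrt_gt_zero)
  \<comment> \<open>A log-concave function is continuous between points where it is positive, hence the larger interval.\<close>
  have "continuous_on {S (\<eta>/2)<..<S (1 - \<eta>/2)} m"
    using \<eta> by (intro log_concave_continuous_on[OF m_log_concave] m_S_pos) auto
  then have cont: "continuous_on {S \<eta>..S (1 - \<eta>)} m"
    by (rule continuous_on_subset) (use S_less[of "\<eta>/2" \<eta>] S_less[of "1 - \<eta>" "1 - \<eta>/2"] \<eta> in auto)
  have subst: "((\<lambda>p. S' p *\<^sub>R m (S p)) has_integral integral {S \<eta>..S (1 - \<eta>)} m) {\<eta>..1 - \<eta>}"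
  proof (rule has_integral_substitution[OF _ _ _ cont])
    show "S \<eta> \<le> S (1 - \<eta>)" using \<eta> by (intro S_le) auto
    show "S ` {\<eta>..1 - \<eta>} \<subseteq> {S \<eta>..S (1 - \<eta>)}" using \<eta> by (auto intro!: S_le)
    show "(S has_real_derivative S' x) (at x within {\<eta>..1 - \<eta>})" if "x \<in> {\<eta>..1 - \<eta>}" for x
      using that \<eta> by (intro DERIV_subset[OF DS]) auto
  qed (use \<eta> in auto)
  have dint: "deficit integrable_on {\<eta>..1 - \<eta>}"
    using \<eta> by (intro integrable_continuous_real continuous_deficit) auto
  have "integral {\<eta>..1 - \<eta>} deficit + (1 - 2 * \<eta>) = integral {\<eta>..1 - \<eta>} (\<lambda>p. deficit p + 1)"
    using \<eta> by (subst Henstock_Kurzweil_Integration.integral_add[OF dint]) auto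
  also have "\<dots> \<le> integral {\<eta>..1 - \<eta>} (\<lambda>p. S' p *\<^sub>R m (S p))"
  proof (rule integral_le)
    show "(\<lambda>p. deficit p + 1) integrable_on {\<eta>..1 - \<eta>}"
      by (intro integrable_add dint) auto
    show "(\<lambda>p. S' p *\<^sub>R m (S p)) integrable_on {\<eta>..1 - \<eta>}" using subst by blast
    show "deficit p + 1 \<le> S' p *\<^sub>R m (S p)" if "p \<in> {\<eta>..1 - \<eta>}" for p
      using mult_left_mono[OF m_S[of p], of "S' p"] S'_pos[of p] that \<eta>
      by (simp add: deficit_def S'_def)
  qed
  also have "\<dots> = integral {S \<eta>..S (1 - \<eta>)} m" using subst by (rule integral_unique)
  also have "\<dots> \<le> integral UNIV m"
    using integrable_on_lborel[OF m_integrable] log_concave_nonneg[OF m_log_concave]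
    by (intro integral_subset_le) (auto intro: integrable_on_subinterval)
  also have "\<dots> = (\<integral>x. m x \<partial>lborel)" using integral_lborel[OF m_integrable] .
  finally show ?thesis .
qed

lemma integral_deficit_mono:
  assumes "0 < a" "a \<le> b" "b \<le> c" "c \<le> d" "d < 1"
  shows "integral {b..c} deficit \<le> integral {a..d} deficit"
  using assms by (intro integral_subset_le integrable_continuous_real continuous_deficit)
    (auto intro: deficit_nonneg)

lemma integral_deficit_le:
  assumes \<eta>: "0 < \<eta>" "\<eta> < 1/2"
  shows "integral {\<eta>..1 - \<eta>} deficit \<le> (\<integral>x. m x \<partial>lborel) - 1"
proof (rule field_le_epsilon)
  fix e :: real assume e: "0 < e"
  define \<delta> where "\<delta> = min \<eta> (e / 2)"
  have \<delta>: "0 < \<delta>" "\<delta> < 1/2" "\<delta> \<le> \<eta>" "2 * \<delta> \<le> e" using e \<eta> by (auto simp: \<delta>_def)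
  have "integral {\<eta>..1 - \<eta>} deficit \<le> integral {\<delta>..1 - \<delta>} deficit"
    using \<delta> \<eta> by (intro integral_deficit_mono) auto
  then show "integral {\<eta>..1 - \<eta>} deficit \<le> (\<integral>x. m x \<partial>lborel) - 1 + e"
    using integral_deficit_add_mass_le[OF \<delta>(1,2)] \<delta>(4) by simp
qed

lemma prekopa_leindler: "1 \<le> (\<integral>x. m x \<partial>lborel)"
proof -
  have "0 \<le> integral {1/4..1 - 1/4} deficit"
  proof (rule Henstock_Kurzweil_Integration.integral_nonneg)
    show "deficit integrable_on {1/4..1 - 1/4}"
      by (intro integrable_continuous_real continuous_deficit) auto
  qed (auto intro: deficit_nonneg)
  then show ?thesis using integral_deficit_le[of "1/4"] by simp
qed

end

section \<open>Stability for log-concave densities\<close>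

context prekopa_triple begin

text \<open>Up to a translation the quantile functions of \<open>f\<close> and \<open>g\<close> agree uniformly on
  \<open>[\<eta>, 1 - \<eta>]\<close>: the difference of their derivatives is controlled by the deficit and by
  \<open>1 / min q (1 - q)\<^sup>2\<close>, whose integral over this interval is of order \<open>1 / \<eta>\<close>. The assumption on the peaks allows all
  bounds to be expressed in terms of \<open>peak g\<close>; the opposite case follows by exchanging \<open>f\<close> and \<open>g\<close>.\<close>

lemma quantiles_close:
  assumes peaks: "peak g \<le> peak f"
    and m: "(\<integral>x. m x \<partial>lborel) \<le> 1 + \<epsilon>" and \<epsilon>: "0 < \<epsilon>"
    and \<eta>: "0 < \<eta>" "\<eta> < 1/2" and p: "p \<in> {\<eta>..1 - \<eta>}"
  shows "\<bar>quantile g p - (quantile f p + (quantile g (1/2) - quantile f (1/2)))\<bar>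
    \<le> 5 * sqrt (\<epsilon> / \<eta>) / peak g"
proof -
  define A where "A = peak g"
  have A: "0 < A" unfolding A_def by (rule G.peak_pos)
  \<comment> \<open>This choice balances the two terms of the bound for the integral of \<open>B\<close> below.\<close>
  define \<kappa> where "\<kappa> = 1 / (A * sqrt (\<epsilon> * \<eta>))"
  have \<kappa>: "0 < \<kappa>" using A \<epsilon> \<eta> by (simp add: \<kappa>_def)
  define Z where "Z q = quantile g q - quantile f q" for q
  define Z' where "Z' q = 1 / I\<^sub>g q - 1 / I\<^sub>f q" for q
  define w where "w q = 1 / q\<^sup>2 + 1 / (1 - q)\<^sup>2" for q :: real
  define B where "B q = \<kappa> * deficit q + 2 / (\<kappa> * A\<^sup>2) * w q" for q
  have DZ: "(Z has_real_derivative Z' q) (at q)" if "0 < q" "q < 1" for q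
    unfolding Z_def Z'_def I\<^sub>f_def I\<^sub>g_def
    using F.DERIV_quantile[OF that] G.DERIV_quantile[OF that]
    by (auto intro!: derivative_eq_intros)
  have Z'B: "\<bar>Z' q\<bar> \<le> B q" if q: "0 < q" "q < 1" for q
  proof -
    define k where "k = A * min q (1 - q)"
    have k: "0 < k" using A q by (simp add: k_def)
    have "k \<le> peak f * min q (1 - q)"
      unfolding k_def A_def using peaks q by (intro mult_right_mono) auto
    then have kf: "k \<le> I\<^sub>f q" using F.quantile_density_lower_bound[OF q] by (simp add: I\<^sub>f_def)
    have kg: "k \<le> I\<^sub>g q" using G.quantile_density_lower_bound[OF q] by (simp add: I\<^sub>g_def k_def A_def)
    have "1 / (min q (1 - q))\<^sup>2 \<le> w q" by (auto simp: w_def min_def)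
    then have "2 / (\<kappa> * A\<^sup>2) * (1 / (min q (1 - q))\<^sup>2) \<le> 2 / (\<kappa> * A\<^sup>2) * w q"
      using \<kappa> A by (intro mult_left_mono) auto
    then have "2 / (\<kappa> * k\<^sup>2) \<le> 2 / (\<kappa> * A\<^sup>2) * w q"
      by (simp add: k_def power_mult_distrib mult.assoc)
    then show ?thesis
      using inverse_diff_le_deficit[OF k kf kg \<kappa>] by (simp add: Z'_def B_def deficit_def)
  qed
  have w_int: "(w has_integral 2 / \<eta> - 2 / (1 - \<eta>)) {\<eta>..1 - \<eta>}"
  proof -
    have "(w has_integral (- 1 / (1 - \<eta>) + 1 / (1 - (1 - \<eta>))) - (- 1 / \<eta> + 1 / (1 - \<eta>))) {\<eta>..1 - \<eta>}"
    proof (rule fundamental_theorem_of_calculus)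
      fix q assume "q \<in> {\<eta>..1 - \<eta>}"
      then have q: "0 < q" "q < 1" using \<eta> by auto
      have "((\<lambda>q. - 1 / q + 1 / (1 - q)) has_real_derivative w q) (at q)"
        using q by (auto intro!: derivative_eq_intros simp: w_def power2_eq_square field_simps)
      then show "((\<lambda>q. - 1 / q + 1 / (1 - q)) has_vector_derivative w q) (at q within {\<eta>..1 - \<eta>})"
        by (simp add: has_real_derivative_iff_has_vector_derivative has_vector_derivative_at_within)
    qed (use \<eta> in auto)
    then show ?thesis by (simp add: algebra_simps)
  qed
  have d_int: "deficit integrable_on {\<eta>..1 - \<eta>}"
    using \<eta> by (intro integrable_continuous_real continuous_deficit) auto
  have B_hi: "(B has_integral \<kappa> * integral {\<eta>..1 - \<eta>} deficit
      + 2 / (\<kappa> * A\<^sup>2) * (2 / \<eta> - 2 / (1 - \<eta>))) {\<eta>..1 - \<eta>}"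
    unfolding B_def using d_int w_int
    by (intro has_integral_add has_integral_mult_right integrable_integral)
  have B_int: "B integrable_on {\<eta>..1 - \<eta>}" using B_hi by blast
  have "integral {\<eta>..1 - \<eta>} B = \<kappa> * integral {\<eta>..1 - \<eta>} deficit
      + 2 / (\<kappa> * A\<^sup>2) * (2 / \<eta> - 2 / (1 - \<eta>))" using B_hi by (rule integral_unique)
  also have "\<dots> \<le> \<kappa> * \<epsilon> + 2 / (\<kappa> * A\<^sup>2) * (2 / \<eta>)"
    using integral_deficit_le[OF \<eta>] m \<kappa> \<eta> A by (intro add_mono mult_left_mono) auto
  also have "\<dots> = 5 * sqrt (\<epsilon> / \<eta>) / A"
  proof -
    define s t where "s = sqrt \<epsilon>" and "t = sqrt \<eta>"
    have st: "0 < s" "0 < t" "\<epsilon> = s\<^sup>2" "\<eta> = t\<^sup>2" "sqrt (\<epsilon> * \<eta>) = s * t" "sqrt (\<epsilon> / \<eta>) = s / t"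
      using \<epsilon> \<eta> by (auto simp: s_def t_def real_sqrt_mult real_sqrt_divide)
    show ?thesis unfolding \<kappa>_def st(5,6) unfolding st(3,4)
      using st(1,2) A by (simp add: field_simps power2_eq_square)
  qed
  finally have B_le: "integral {\<eta>..1 - \<eta>} B \<le> 5 * sqrt (\<epsilon> / \<eta>) / A" .
  have osc: "\<bar>Z b - Z a\<bar> \<le> 5 * sqrt (\<epsilon> / \<eta>) / A" if ab: "\<eta> \<le> a" "a \<le> b" "b \<le> 1 - \<eta>" for a b
  proof -
    have "(Z' has_integral Z b - Z a) {a..b}"
      using ab \<eta> by (intro fundamental_theorem_of_calculus)
        (auto intro!: has_vector_derivative_at_within[OF DZ[unfolded has_real_derivative_iff_has_vector_derivative]])
    then have "norm (Z b - Z a) \<le> integral {a..b} B"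
      using integral_norm_bound_integral[of Z' "{a..b}" B] Z'B ab \<eta>
        integrable_subinterval_real[OF B_int, of a b]
      by (auto simp: has_integral_iff)
    also have "\<dots> \<le> integral {\<eta>..1 - \<eta>} B"
      using ab \<eta> order_trans[OF abs_ge_zero Z'B]
      by (intro integral_subset_le B_int integrable_subinterval_real[OF B_int]) auto
    finally show ?thesis using B_le by simp
  qed
  have "\<bar>Z p - Z (1/2)\<bar> \<le> 5 * sqrt (\<epsilon> / \<eta>) / A"
    using osc[of p "1/2"] osc[of "1/2" p] p \<eta> by (cases "p \<le> 1/2") (auto simp: abs_minus_commute)
  then show ?thesis by (simp add: Z_def A_def algebra_simps)
qed

text \<open>The excess of \<open>f\<close> over the translate of \<open>g\<close>, at a point \<open>x = quantile f p\<close>, is split by inserting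
  the value \<open>I\<^sub>g p = g (quantile g p)\<close>. The part \<open>f x - I\<^sub>g p\<close> is bounded by the deficit. The part
  \<open>I\<^sub>g p - g (x + c)\<close> compares \<open>g\<close> at two points of distance at most \<open>d\<close> and is bounded by the
  sliding maximum of \<open>g\<close>. The tails outside \<open>[\<eta>, 1 - \<eta>]\<close> contribute \<open>2 * \<eta>\<close>.\<close>

lemma excess_le:
  assumes peaks: "peak g \<le> peak f"
    and m: "(\<integral>x. m x \<partial>lborel) \<le> 1 + \<epsilon>" and \<epsilon>: "0 < \<epsilon>"
    and \<eta>: "0 < \<eta>" "\<eta> < 1/2"
  defines "c \<equiv> quantile g (1/2) - quantile f (1/2)"
  shows "(\<integral>x. max 0 (f x - g (x + c)) \<partial>lborel) \<le> 2 * \<eta> + 9/2 * sqrt \<epsilon> + 10 * sqrt (\<epsilon> / \<eta>)"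
proof -
  define d where "d = 5 * sqrt (\<epsilon> / \<eta>) / peak g"
  have d: "0 \<le> d" using G.peak_pos \<epsilon> \<eta> by (simp add: d_def)
  obtain k where k: "integrable lborel k" "\<And>x y. \<bar>y - x\<bar> \<le> d \<Longrightarrow> g y \<le> k x"
    "(\<integral>x. k x \<partial>lborel) \<le> 1 + 2 * d * peak g" using G.sliding_maximum[OF d] by blast
  define x0 x1 where "x0 = quantile f \<eta>" and "x1 = quantile f (1 - \<eta>)"
  have x01: "x0 \<le> x1" "mass_below f x0 = \<eta>" "mass_below f x1 = 1 - \<eta>" "x0 \<in> F.bulk" "x1 \<in> F.bulk"
    using \<eta> by (auto simp: x0_def x1_def intro: F.quantile_mono F.mass_below_quantile F.quantile_in_bulk)
  define W where "W p = max 0 (1 - I\<^sub>g p / I\<^sub>f p)" for p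
  have contW: "continuous_on {\<eta>..1 - \<eta>} W"
  proof -
    have "I\<^sub>f p \<noteq> 0" if "p \<in> {\<eta>..1 - \<eta>}" for p using I_pos[of p] that \<eta> by auto
    then show ?thesis
      unfolding W_def using \<eta> by (intro continuous_intros continuous_I) auto
  qed
  define h1 where "h1 x = indicator {x0..x1} x * f x" for x
  define h2 where "h2 x = indicator {x0..x1} x * (f x * W (mass_below f x))" for x
  define h3 where "h3 x = k (c + 1 * x) - g (c + 1 * x)" for x
  have i1: "integrable lborel h1" unfolding h1_def by (intro F.integrable_indicator) auto
  have x01_bulk: "x \<in> F.bulk" if "x \<in> {x0..x1}" for x using F.bulk_between[OF x01(4,5)] that by auto
  have mass_in: "mass_below f x \<in> {\<eta>..1 - \<eta>}" if "x \<in> {x0..x1}" for x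
    using F.mass_below_mono[of x0 x] F.mass_below_mono[of x x1] x01 that by auto
  have cont2: "continuous_on {x0..x1} (\<lambda>x. f x * W (mass_below f x))"
    by (intro continuous_intros continuous_on_compose2[OF contW] F.continuous_mass_below
        continuous_at_imp_continuous_on) (use mass_in in \<open>auto intro!: F.isCont_bulk x01_bulk\<close>)
  have s2: "set_integrable lborel {x0..x1} (\<lambda>x. f x * W (mass_below f x))"
    by (rule borel_integrable_atLeastAtMost'[OF cont2])
  have i2: "integrable lborel h2" using s2 unfolding set_integrable_def h2_def by simp
  have i3': "integrable lborel (\<lambda>x. k (c + 1 * x))" "integrable lborel (\<lambda>x. g (c + 1 * x))"
    using lborel_integrable_real_affine[OF k(1), of 1 c] lborel_integrable_real_affine[OF G.integrable, of 1 c]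
    by simp_all
  have i3: "integrable lborel h3" unfolding h3_def using i3' by (intro Bochner_Integration.integrable_diff)
  have e1: "(\<integral>x. h1 x \<partial>lborel) = 1 - 2 * \<eta>"
  proof -
    have "(\<integral>x. h1 x \<partial>lborel) = (LINT x:{x0..x1}|lborel. f x)"
      by (simp add: set_lebesgue_integral_def h1_def)
    also have "\<dots> = integral {x0..x1} f"
      using F.integrable_indicator[of "{x0..x1}"]
      by (intro set_borel_integral_eq_integral) (simp add: set_integrable_def)
    also have "\<dots> = 1 - 2 * \<eta>" using F.mass_below_diff[OF x01(1)] x01 by simp
    finally show ?thesis .
  qed
  have e2: "(\<integral>x. h2 x \<partial>lborel) \<le> 9/2 * sqrt \<epsilon>"
  proof -
    have "(\<integral>x. h2 x \<partial>lborel) = (LINT x:{x0..x1}|lborel. f x * W (mass_below f x))"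
      by (simp add: set_lebesgue_integral_def h2_def)
    also have "\<dots> = integral {x0..x1} (\<lambda>x. f x *\<^sub>R W (mass_below f x))"
      using set_borel_integral_eq_integral(2)[OF s2] by simp
    also have "\<dots> = integral {mass_below f x0..mass_below f x1} W"
    proof (rule integral_unique, rule has_integral_substitution[OF _ _ _ contW])
      show "mass_below f ` {x0..x1} \<subseteq> {\<eta>..1 - \<eta>}" using mass_in by auto
      show "(mass_below f has_real_derivative f x) (at x within {x0..x1})" if "x \<in> {x0..x1}" for x
        using F.DERIV_mass_below[OF x01_bulk[OF that]] by (rule DERIV_subset) simp
    qed (use x01 \<eta> in auto)
    also have "\<dots> = integral {\<eta>..1 - \<eta>} W" using x01 by simp
    also have "\<dots> \<le> integral {\<eta>..1 - \<eta>} (\<lambda>p. 4 / sqrt \<epsilon> * deficit p + sqrt \<epsilon> / 2)"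
    proof (rule integral_le)
      show "W integrable_on {\<eta>..1 - \<eta>}" by (rule integrable_continuous_real[OF contW])
      show "(\<lambda>p. 4 / sqrt \<epsilon> * deficit p + sqrt \<epsilon> / 2) integrable_on {\<eta>..1 - \<eta>}"
        using \<eta> by (intro integrable_continuous_real continuous_intros continuous_deficit) auto
      show "W p \<le> 4 / sqrt \<epsilon> * deficit p + sqrt \<epsilon> / 2" if "p \<in> {\<eta>..1 - \<eta>}" for p
        unfolding W_def deficit_def using that \<eta> \<epsilon> by (intro excess_ratio_le_deficit I_pos) auto
    qed
    also have "\<dots> = 4 / sqrt \<epsilon> * integral {\<eta>..1 - \<eta>} deficit + sqrt \<epsilon> / 2 * (1 - 2 * \<eta>)"
    proof -
      have "deficit integrable_on {\<eta>..1 - \<eta>}"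
        using \<eta> by (intro integrable_continuous_real continuous_deficit) auto
      from has_integral_add[OF has_integral_mult_right[OF integrable_integral[OF this], of "4 / sqrt \<epsilon>"]
          has_integral_const_real[of "sqrt \<epsilon> / 2" \<eta> "1 - \<eta>"]]
      show ?thesis using \<eta> by (intro integral_unique) (simp add: mult.commute)
    qed
    also have "\<dots> \<le> 4 / sqrt \<epsilon> * \<epsilon> + sqrt \<epsilon> / 2 * 1"
      using integral_deficit_le[OF \<eta>] m \<epsilon> \<eta> by (intro add_mono mult_left_mono) auto
    also have "\<dots> = 9/2 * sqrt \<epsilon>"
      using real_div_sqrt[of \<epsilon>] \<epsilon> by simp
    finally show ?thesis .
  qed
  have e3: "(\<integral>x. h3 x \<partial>lborel) \<le> 10 * sqrt (\<epsilon> / \<eta>)"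
  proof -
    have "(\<integral>x. h3 x \<partial>lborel) = (\<integral>x. k x \<partial>lborel) - (\<integral>x. g x \<partial>lborel)"
      unfolding h3_def Bochner_Integration.integral_diff[OF i3']
      using lborel_integral_real_affine[of 1 k c] lborel_integral_real_affine[of 1 g c] by simp
    also have "\<dots> \<le> 2 * d * peak g" using k(3) G.total_mass by simp
    also have "\<dots> = 10 * sqrt (\<epsilon> / \<eta>)" using G.peak_pos by (simp add: d_def)
    finally show ?thesis .
  qed
  have pointwise: "max 0 (f x - g (x + c)) \<le> f x - h1 x + h2 x + h3 x" for x
  proof -
    have h3: "0 \<le> h3 x" using k(2)[of "c + 1 * x" "c + 1 * x"] d by (simp add: h3_def)
    show ?thesis
    proof (cases "x \<in> {x0..x1}")
      case False
      then show ?thesis using h3 F.nonneg[of x] G.nonneg[of "x + c"] by (simp add: h1_def h2_def)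
    next
      case True
      define p where "p = mass_below f x"
      have p: "p \<in> {\<eta>..1 - \<eta>}" using mass_in[OF True] by (simp add: p_def)
      have qp: "quantile f p = x" unfolding p_def by (rule F.quantile_mass_below[OF x01_bulk[OF True]])
      have "\<bar>quantile g p - (c + 1 * x)\<bar> \<le> d"
        using quantiles_close[OF peaks m \<epsilon> \<eta> p] by (simp add: qp c_def d_def algebra_simps)
      then have "I\<^sub>g p \<le> k (c + 1 * x)" unfolding I\<^sub>g_def by (rule k(2))
      moreover have "f x - I\<^sub>g p \<le> f x * W p"
      proof -
        have fx: "0 < f x" "I\<^sub>f p = f x" using F.pos_bulk[OF x01_bulk[OF True]] by (auto simp: I\<^sub>f_def qp)
        have "f x - I\<^sub>g p = f x * (1 - I\<^sub>g p / I\<^sub>f p)" using fx by (simp add: algebra_simps)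
        also have "\<dots> \<le> f x * W p" using fx by (intro mult_left_mono) (auto simp: W_def)
        finally show ?thesis .
      qed
      moreover have "0 \<le> f x * W p" using F.nonneg by (simp add: W_def)
      ultimately show ?thesis using True h3
        by (simp add: h1_def h2_def h3_def p_def[symmetric] add.commute)
    qed
  qed
  have "(\<integral>x. max 0 (f x - g (x + c)) \<partial>lborel) \<le> (\<integral>x. f x - h1 x + h2 x + h3 x \<partial>lborel)"
  proof (rule integral_mono)
    show "integrable lborel (\<lambda>x. max 0 (f x - g (x + c)))"
      using F.integrable i3'(2) by (intro integrable_max Bochner_Integration.integrable_diff) (auto simp: add.commute)
    show "integrable lborel (\<lambda>x. f x - h1 x + h2 x + h3 x)"
      by (intro Bochner_Integration.integrable_add Bochner_Integration.integrable_diff F.integrable i1 i2 i3)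
  qed (rule pointwise)
  also have "\<dots> = 1 - (1 - 2 * \<eta>) + (\<integral>x. h2 x \<partial>lborel) + (\<integral>x. h3 x \<partial>lborel)"
    using F.integrable i1 i2 i3 by (simp add: F.total_mass e1)
  finally show ?thesis using e2 e3 by simp
qed

text \<open>With \<open>\<eta> = root 3 \<epsilon>\<close> all terms of the bound for the excess are of order \<open>root 3 \<epsilon>\<close>. The
  hypothesis at the midpoint of \<open>t\<close> and \<open>t + c\<close> shows that \<open>m\<close>, translated by \<open>c / 2\<close>, lies above
  the minimum of \<open>f\<close> and the translated \<open>g\<close>; as the three functions have almost equal integrals,
  they are close in \<open>L\<^sup>1\<close>.\<close>

lemma stability_if_peak_le:
  assumes peaks: "peak g \<le> peak f"
    and m: "(\<integral>x. m x \<partial>lborel) \<le> 1 + \<epsilon>" and \<epsilon>: "0 < \<epsilon>" "\<epsilon> < 1/8"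
  shows "\<exists>b. (\<integral>t. \<bar>f t - m (t + b)\<bar> \<partial>lborel) \<le> 34 * root 3 \<epsilon>
           \<and> (\<integral>t. \<bar>g t - m (t - b)\<bar> \<partial>lborel) \<le> 34 * root 3 \<epsilon>"
proof -
  \<comment> \<open>The truncation level \<open>\<eta>\<close>.\<close>
  define h where "h = root 3 \<epsilon>"
  have h3: "h ^ 3 = \<epsilon>" using \<epsilon> by (simp add: h_def)
  have h: "0 < h" "h < 1/2"
  proof -
    show "0 < h" using \<epsilon> by (simp add: h_def)
    have "h ^ 3 < (1/2) ^ 3" using h3 \<epsilon> by (simp add: power3_eq_cube)
    then show "h < 1/2" by (rule power_less_imp_less_base) simp
  qed
  define c where "c = quantile g (1/2) - quantile f (1/2)"
  define E where "E x = max 0 (f x - g (x + c))" for x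
  define \<kappa> where "\<kappa> = (\<integral>x. E x \<partial>lborel)"
  have shift: "integrable lborel (\<lambda>t. u (s + 1 * t))"
    "(\<integral>t. u (s + 1 * t) \<partial>lborel) = (\<integral>t. u t \<partial>lborel)" if "integrable lborel u" for u :: "real \<Rightarrow> real" and s
    using lborel_integrable_real_affine[OF that, of 1 s] lborel_integral_real_affine[of 1 u s] by auto
  have "\<kappa> \<le> 2 * h + 9/2 * sqrt \<epsilon> + 10 * sqrt (\<epsilon> / h)"
    unfolding \<kappa>_def E_def c_def by (rule excess_le[OF peaks m \<epsilon>(1) h])
  also have "sqrt (\<epsilon> / h) = h"
    unfolding h3[symmetric] using h by (simp add: power3_eq_cube)
  also have "sqrt \<epsilon> \<le> h"
  proof (rule real_le_lsqrt)
    have "h ^ 3 \<le> h ^ 2" using h by (intro power_decreasing) auto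
    then show "\<epsilon> \<le> h\<^sup>2" using h3 by simp
  qed (use h in auto)
  finally have \<kappa>: "\<kappa> \<le> 33/2 * h" by simp
  have \<epsilon>h: "\<epsilon> \<le> h"
    using power_decreasing[of 1 3 h] h h3 by simp
  note mi = shift[OF m_integrable, of "c/2"]
  note gi = shift[OF G.integrable, of c]
  have Ei: "integrable lborel E"
    unfolding E_def using F.integrable gi
    by (intro integrable_max Bochner_Integration.integrable_diff) (auto simp: add.commute)
  have m_min: "min (f t) (g (t + c)) \<le> m (c/2 + 1 * t)" for t
  proof -
    define k where "k = min (f t) (g (t + c))"
    have k: "0 \<le> k" "k \<le> f t" "k \<le> g (t + c)" using F.nonneg G.nonneg by (auto simp: k_def)
    have "k = sqrt (k * k)" using k by simp
    also have "\<dots> \<le> sqrt (f t * g (t + c))" using k by (intro real_sqrt_le_mono mult_mono) auto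
    also have "\<dots> \<le> m ((t + (t + c)) / 2)" by (rule m_ge)
    also have "(t + (t + c)) / 2 = c/2 + 1 * t" by (simp add: field_simps)
    finally show ?thesis by (simp add: k_def)
  qed
  have "(\<integral>t. \<bar>f t - m (c/2 + 1 * t)\<bar> \<partial>lborel) \<le> (\<integral>t. m (c/2 + 1 * t) - f t + 2 * E t \<partial>lborel)"
  proof (rule integral_mono)
    show "\<bar>f t - m (c/2 + 1 * t)\<bar> \<le> m (c/2 + 1 * t) - f t + 2 * E t" for t
      using m_min[of t] by (auto simp: E_def max_def min_def split: if_splits)
  qed (intro Bochner_Integration.integrable_add Bochner_Integration.integrable_diff integrable_abs
      integrable_mult_right F.integrable mi(1) Ei)+
  also have "\<dots> = (\<integral>x. m x \<partial>lborel) - 1 + 2 * \<kappa>"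
    using mi F.integrable Ei by (simp add: F.total_mass \<kappa>_def)
  also have "\<dots> \<le> 34 * h" using m \<kappa> \<epsilon>h by simp
  finally have 1: "(\<integral>t. \<bar>f t - m (t + c/2)\<bar> \<partial>lborel) \<le> 34 * h" by (simp add: add.commute)
  have gm: "integrable lborel (\<lambda>t. \<bar>g t - m (t - c/2)\<bar>)"
    using shift(1)[OF m_integrable, of "- c/2"] by (intro integrable_abs Bochner_Integration.integrable_diff G.integrable) simp
  have "(\<integral>t. \<bar>g t - m (t - c/2)\<bar> \<partial>lborel) = (\<integral>t. \<bar>g (c + 1 * t) - m (c/2 + 1 * t)\<bar> \<partial>lborel)"
    using shift(2)[OF gm, of c] by (simp add: algebra_simps)
  also have "\<dots> \<le> (\<integral>t. m (c/2 + 1 * t) + g (c + 1 * t) - 2 * f t + 2 * E t \<partial>lborel)"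
  proof (rule integral_mono)
    show "\<bar>g (c + 1 * t) - m (c/2 + 1 * t)\<bar> \<le> m (c/2 + 1 * t) + g (c + 1 * t) - 2 * f t + 2 * E t" for t
      using m_min[of t] by (auto simp: E_def max_def min_def add.commute split: if_splits)
  qed (intro Bochner_Integration.integrable_add Bochner_Integration.integrable_diff integrable_abs
      integrable_mult_right F.integrable mi(1) gi(1) Ei)+
  also have "\<dots> = (\<integral>x. m x \<partial>lborel) - 1 + 2 * \<kappa>"
    using mi gi F.integrable Ei by (simp add: F.total_mass G.total_mass \<kappa>_def)
  also have "\<dots> \<le> 34 * h" using m \<kappa> \<epsilon>h by simp
  finally show ?thesis using 1 unfolding h_def by blast
qed

lemma stability:
  assumes m: "(\<integral>x. m x \<partial>lborel) \<le> 1 + \<epsilon>" and \<epsilon>: "0 < \<epsilon>" "\<epsilon> < 1/8"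
  shows "\<exists>b. (\<integral>t. \<bar>f t - m (t + b)\<bar> \<partial>lborel) \<le> 34 * root 3 \<epsilon>
           \<and> (\<integral>t. \<bar>g t - m (t - b)\<bar> \<partial>lborel) \<le> 34 * root 3 \<epsilon>"
proof (cases "peak g \<le> peak f")
  case True
  then show ?thesis using stability_if_peak_le m \<epsilon> by blast
next
  case False
  interpret swapped: prekopa_triple g f m by (rule swap)
  obtain b where "(\<integral>t. \<bar>g t - m (t + b)\<bar> \<partial>lborel) \<le> 34 * root 3 \<epsilon>"
    "(\<integral>t. \<bar>f t - m (t - b)\<bar> \<partial>lborel) \<le> 34 * root 3 \<epsilon>"
    using swapped.stability_if_peak_le[OF _ m \<epsilon>] False by auto
  then show ?thesis by (intro exI[of _ "- b"]) simp
qed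

end

lemma log_concave_scale:
  assumes h: "log_concave h" and k: "0 \<le> k"
  shows "log_concave (\<lambda>x. k * h x)"
  unfolding log_concave_def
proof (intro conjI allI impI)
  show "0 \<le> k * h x" for x using log_concave_nonneg[OF h] k by simp
  fix x y l :: real assume l: "0 < l \<and> l < 1"
  have "(k * h x) powr (1 - l) * (k * h y) powr l
      = (k powr (1 - l) * k powr l) * (h x powr (1 - l) * h y powr l)"
    using k log_concave_nonneg[OF h] by (simp add: powr_mult)
  also have "\<dots> \<le> k * h ((1 - l) * x + l * y)"
    using log_concaveD[OF h, of l x y] l k by (simp add: powr_one_minus_mult_powr mult_left_mono)
  finally show "(k * h x) powr (1 - l) * (k * h y) powr l \<le> k * h ((1 - l) * x + l * y)" .
qed

lemma log_concave_density_normalize: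
  assumes h: "log_concave h" "integrable lborel h" and k: "(\<integral>x. h x \<partial>lborel) = k" "0 < k"
  shows "log_concave_density (\<lambda>x. h x / k)"
proof
  show "log_concave (\<lambda>x. h x / k)" using log_concave_scale[OF h(1), of "1 / k"] k by simp
  show "integrable lborel (\<lambda>x. h x / k)" using h(2) by simp
  show "(\<integral>x. h x / k \<partial>lborel) = 1" using k by simp
qed

lemma log_concave_integrable_bounded:
  assumes h: "log_concave h" "integrable lborel h" "0 < (\<integral>x. h x \<partial>lborel)"
  obtains K where "0 \<le> K" "\<And>x. h x \<le> K"
proof -
  define k where "k = (\<integral>x. h x \<partial>lborel)"
  interpret log_concave_density "\<lambda>x. h x / k"
    using h by (intro log_concave_density_normalize) (simp_all add: k_def)
  have k: "0 < k" using h by (simp add: k_def)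
  show ?thesis
  proof (rule that)
    show "0 \<le> peak (\<lambda>x. h x / k) * k" using peak_pos k by simp
    show "h x \<le> peak (\<lambda>x. h x / k) * k" for x using le_peak[of x] k by (simp add: pos_divide_le_eq)
  qed
qed

text \<open>Both the inequality and its stability for log-concave functions of arbitrary mass, by
  normalization. The factor \<open>a\<close> is fixed by the requirement that \<open>f\<close> and \<open>a * m\<close> have the same mass
  in the case of equality.\<close>

lemma stability_log_concave:
  fixes f g m :: "real \<Rightarrow> real"
  assumes f: "log_concave f" "integrable lborel f" "(\<integral>x. f x \<partial>lborel) = p" "0 < p"
    and g: "log_concave g" "integrable lborel g" "(\<integral>x. g x \<partial>lborel) = q" "0 < q"
    and m: "log_concave m" "integrable lborel m" "(\<integral>x. m x \<partial>lborel) = M"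
    and dom: "\<And>r s. sqrt (f r * g s) \<le> m ((r + s) / 2)"
  defines "a \<equiv> sqrt (p / q)"
  shows "sqrt (p * q) \<le> M"
    and "0 < \<epsilon> \<Longrightarrow> \<epsilon> < 1/8 \<Longrightarrow> M \<le> (1 + \<epsilon>) * sqrt (p * q) \<Longrightarrow>
      \<exists>b. (\<integral>t. \<bar>f t - a * m (t + b)\<bar> \<partial>lborel) \<le> 34 * root 3 \<epsilon> * (a * M)
        \<and> (\<integral>t. \<bar>g t - inverse a * m (t - b)\<bar> \<partial>lborel) \<le> 34 * root 3 \<epsilon> * (inverse a * M)"
proof -
  define R where "R = sqrt (p * q)"
  have R: "0 < R" using f g by (simp add: R_def)
  have a: "0 < a" using f g by (simp add: a_def)
  have aR: "p = a * R" "q = inverse a * R"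
    using f(4) g(4) by (simp_all add: a_def R_def real_sqrt_mult real_sqrt_divide field_simps)
  interpret F: log_concave_density "\<lambda>x. f x / p" using f by (intro log_concave_density_normalize)
  interpret G: log_concave_density "\<lambda>x. g x / q" using g by (intro log_concave_density_normalize)
  interpret prekopa_triple "\<lambda>x. f x / p" "\<lambda>x. g x / q" "\<lambda>x. m x / R"
  proof
    show "log_concave (\<lambda>x. m x / R)" using log_concave_scale[OF m(1), of "1 / R"] R by simp
    show "integrable lborel (\<lambda>x. m x / R)" using m(2) by simp
    fix r s
    have "sqrt (f r / p * (g s / q)) = sqrt (f r * g s) / R"
      by (simp add: R_def real_sqrt_mult real_sqrt_divide)
    also have "\<dots> \<le> m ((r + s) / 2) / R" using dom R by (simp add: divide_right_mono)
    finally show "sqrt (f r / p * (g s / q)) \<le> m ((r + s) / 2) / R" .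
  qed
  have mass: "(\<integral>x. m x / R \<partial>lborel) = M / R" using m(3) by simp
  show RM: "sqrt (p * q) \<le> M"
    using prekopa_leindler R unfolding mass by (simp add: R_def pos_le_divide_eq)
  assume \<epsilon>: "0 < \<epsilon>" "\<epsilon> < 1/8" and le: "M \<le> (1 + \<epsilon>) * sqrt (p * q)"
  have "(\<integral>x. m x / R \<partial>lborel) \<le> 1 + \<epsilon>"
    unfolding mass using le R by (simp add: R_def pos_divide_le_eq)
  from stability[OF this \<epsilon>] obtain b where
    b: "(\<integral>t. \<bar>f t / p - m (t + b) / R\<bar> \<partial>lborel) \<le> 34 * root 3 \<epsilon>"
       "(\<integral>t. \<bar>g t / q - m (t - b) / R\<bar> \<partial>lborel) \<le> 34 * root 3 \<epsilon>" by blast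
  have h: "0 \<le> 34 * root 3 \<epsilon>" using \<epsilon> by simp
  have scale: "(\<integral>t. \<bar>u t - k * v t\<bar> \<partial>lborel) \<le> 34 * root 3 \<epsilon> * (k * M)"
    if k: "0 < k" and u: "(\<integral>t. \<bar>u t / (k * R) - v t / R\<bar> \<partial>lborel) \<le> 34 * root 3 \<epsilon>" for u v :: "real \<Rightarrow> real" and k
  proof -
    have "\<bar>u t - k * v t\<bar> = (k * R) * \<bar>u t / (k * R) - v t / R\<bar>" for t
    proof -
      have "u t - k * v t = (k * R) * (u t / (k * R) - v t / R)" using k R by (simp add: field_simps)
      then show ?thesis using k R by (simp only: abs_mult)
    qed
    then have "(\<integral>t. \<bar>u t - k * v t\<bar> \<partial>lborel) = (k * R) * (\<integral>t. \<bar>u t / (k * R) - v t / R\<bar> \<partial>lborel)"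
      by simp
    also have "\<dots> \<le> (k * R) * (34 * root 3 \<epsilon>)" using k R u by (intro mult_left_mono) auto
    also have "\<dots> \<le> (k * M) * (34 * root 3 \<epsilon>)"
      using RM k h by (intro mult_right_mono mult_left_mono) (auto simp: R_def)
    finally show ?thesis by (simp only: mult.commute)
  qed
  show "\<exists>b. (\<integral>t. \<bar>f t - a * m (t + b)\<bar> \<partial>lborel) \<le> 34 * root 3 \<epsilon> * (a * M)
        \<and> (\<integral>t. \<bar>g t - inverse a * m (t - b)\<bar> \<partial>lborel) \<le> 34 * root 3 \<epsilon> * (inverse a * M)"
  proof (intro exI conjI)
    show "(\<integral>t. \<bar>f t - a * m (t + b)\<bar> \<partial>lborel) \<le> 34 * root 3 \<epsilon> * (a * M)"
      by (rule scale[OF a b(1)[unfolded aR(1)]])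
    show "(\<integral>t. \<bar>g t - inverse a * m (t - b)\<bar> \<partial>lborel) \<le> 34 * root 3 \<epsilon> * (inverse a * M)"
      by (rule scale[OF positive_imp_inverse_positive[OF a] b(2)[unfolded aR(2)]])
  qed
qed

section \<open>Reduction to log-concave functions\<close>

text \<open>The largest function \<open>f\<close> with \<open>f r * g s \<le> (m ((r + s) / 2))\<^sup>2\<close> for all \<open>r\<close> and \<open>s\<close>. It is log-concave
  because \<open>m\<close> is, whatever the function \<open>g\<close>. Points \<open>s\<close> with \<open>g s = 0\<close> impose no condition and are
  left out of the infimum, so that \<open>g\<close> must be positive somewhere.\<close>

definition envelope :: "(real \<Rightarrow> real) \<Rightarrow> (real \<Rightarrow> real) \<Rightarrow> real \<Rightarrow> real" where
  "envelope m g r = (INF s\<in>{s. 0 < g s}. (m ((r + s) / 2))\<^sup>2 / g s)"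

context
  fixes m g :: "real \<Rightarrow> real"
  assumes m: "log_concave m" and g: "\<And>s. 0 \<le> g s" "\<exists>s. 0 < g s"
begin

lemma envelope_le: "0 < g s \<Longrightarrow> envelope m g r \<le> (m ((r + s) / 2))\<^sup>2 / g s"
  unfolding envelope_def by (intro cINF_lower bdd_belowI2[of _ 0]) auto

lemma envelope_greatest:
  "(\<And>s. 0 < g s \<Longrightarrow> k \<le> (m ((r + s) / 2))\<^sup>2 / g s) \<Longrightarrow> k \<le> envelope m g r"
  unfolding envelope_def using g(2) by (intro cINF_greatest) auto

lemma envelope_nonneg: "0 \<le> envelope m g r"
  by (intro envelope_greatest) simp

lemma envelope_dominated: "sqrt (envelope m g r * g s) \<le> m ((r + s) / 2)"
proof (cases "g s = 0")
  case False
  then have s: "0 < g s" using g(1)[of s] by simp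
  have "envelope m g r * g s \<le> (m ((r + s) / 2))\<^sup>2"
    using envelope_le[OF s, of r] s by (simp add: pos_le_divide_eq)
  then show ?thesis
    using log_concave_nonneg[OF m] envelope_nonneg s by (intro real_le_lsqrt) auto
qed (simp add: log_concave_nonneg[OF m])

lemma le_envelope:
  assumes "\<And>s. sqrt (k * g s) \<le> m ((r + s) / 2)"
  shows "k \<le> envelope m g r"
  using sqrt_le_D[OF assms] by (intro envelope_greatest) (simp add: pos_le_divide_eq)

lemma log_concave_envelope: "log_concave (envelope m g)"
  unfolding log_concave_def
proof (intro conjI allI impI envelope_nonneg envelope_greatest)
  fix x y l s :: real assume l: "0 < l \<and> l < 1" and s: "0 < g s"
  define u v where "u = m ((x + s) / 2)" and "v = m ((y + s) / 2)"
  have uv: "0 \<le> u" "0 \<le> v" by (simp_all add: u_def v_def log_concave_nonneg[OF m])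
  have mid: "(((1 - l) * x + l * y) + s) / 2 = (1 - l) * ((x + s) / 2) + l * ((y + s) / 2)"
    by (simp add: field_simps)
  have "envelope m g x powr (1 - l) * envelope m g y powr l
      \<le> (u\<^sup>2 / g s) powr (1 - l) * (v\<^sup>2 / g s) powr l"
    unfolding u_def v_def using l envelope_le[OF s] envelope_nonneg
    by (intro mult_mono powr_mono2) auto
  also have "\<dots> = (u powr (1 - l) * v powr l)\<^sup>2 / (g s powr (1 - l) * g s powr l)"
    using uv s by (simp add: powr_divide powr_mult power2_eq_square)
  also have "\<dots> = (u powr (1 - l) * v powr l)\<^sup>2 / g s"
    using s by (simp add: powr_one_minus_mult_powr)
  also have "\<dots> \<le> (m ((((1 - l) * x + l * y) + s) / 2))\<^sup>2 / g s"
    unfolding mid u_def v_def using log_concaveD[OF m, of l "(x + s) / 2" "(y + s) / 2"] l s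
    by (intro divide_right_mono power_mono) auto
  finally show "envelope m g x powr (1 - l) * envelope m g y powr l
      \<le> (m ((((1 - l) * x + l * y) + s) / 2))\<^sup>2 / g s" .
qed

lemma integrable_envelope:
  assumes mi: "integrable lborel m" "0 < (\<integral>x. m x \<partial>lborel)"
  shows "integrable lborel (envelope m g)"
proof -
  obtain s where s: "0 < g s" using g(2) by blast
  obtain K where K: "0 \<le> K" "\<And>x. m x \<le> K" using log_concave_integrable_bounded[OF m mi] by blast
  have "integrable lborel (\<lambda>r. K / g s * m (s / 2 + 1 / 2 * r))"
    by (intro integrable_mult_right lborel_integrable_real_affine mi(1)) simp
  then show ?thesis
  proof (rule Bochner_Integration.integrable_bound)
    show "envelope m g \<in> borel_measurable lborel"
      using log_concave_borel_measurable[OF log_concave_envelope] by simp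
    show "AE r in lborel. norm (envelope m g r) \<le> norm (K / g s * m (s / 2 + 1 / 2 * r))"
    proof (rule AE_I2)
      fix r
      have e: "(r + s) / 2 = s / 2 + 1 / 2 * r" by (simp add: field_simps)
      have "envelope m g r \<le> (m ((r + s) / 2))\<^sup>2 / g s" by (rule envelope_le[OF s])
      also have "\<dots> \<le> (K * m ((r + s) / 2)) / g s"
        unfolding power2_eq_square using K log_concave_nonneg[OF m] s
        by (intro divide_right_mono mult_right_mono) auto
      finally have "envelope m g r \<le> K / g s * m (s / 2 + 1 / 2 * r)" unfolding e by simp
      then show "norm (envelope m g r) \<le> norm (K / g s * m (s / 2 + 1 / 2 * r))"
        unfolding real_norm_def
        using envelope_nonneg[of r] by linarith
    qed
  qed
qed

end

lemma integral_pos_imp_ex_pos: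
  fixes f :: "'a \<Rightarrow> real"
  assumes "0 < (\<integral>x. f x \<partial>M)" "\<And>x. 0 \<le> f x"
  shows "\<exists>x. 0 < f x"
proof (rule ccontr)
  assume "\<not> ?thesis"
  then have "f x = 0" for x using assms(2)[of x] by (simp add: not_less antisym)
  then show False using assms(1) by simp
qed

text \<open>The given functions are only Lebesgue measurable, whereas log-concave functions are Borel
  measurable; the estimate passes from the completed measure to \<open>lborel\<close>.\<close>

lemma L1_dist_via_majorant:
  fixes f f' v :: "real \<Rightarrow> real"
  assumes f: "integrable lebesgue f" "(\<integral>x. f x \<partial>lebesgue) = P"
    and f': "integrable lborel f'" "(\<integral>x. f' x \<partial>lborel) = P'"
    and v: "integrable lborel v" and le: "\<And>x. f x \<le> f' x"
  shows "(\<integral>x. \<bar>f x - v x\<bar> \<partial>lebesgue) \<le> (\<integral>x. \<bar>f' x - v x\<bar> \<partial>lborel) + (P' - P)"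
proof -
  have m: "f' \<in> borel_measurable lborel" "v \<in> borel_measurable lborel" using f' v by auto
  have i: "integrable lebesgue f'" "integrable lebesgue v"
    using f' v m by (simp_all add: integrable_completion)
  have "(\<integral>x. \<bar>f x - v x\<bar> \<partial>lebesgue) \<le> (\<integral>x. \<bar>f' x - v x\<bar> + (f' x - f x) \<partial>lebesgue)"
  proof (rule integral_mono)
    show "\<bar>f x - v x\<bar> \<le> \<bar>f' x - v x\<bar> + (f' x - f x)" for x using le[of x] by simp
  qed (intro Bochner_Integration.integrable_add Bochner_Integration.integrable_diff integrable_abs i f(1))+
  also have "\<dots> = (\<integral>x. \<bar>f' x - v x\<bar> \<partial>lebesgue) + ((\<integral>x. f' x \<partial>lebesgue) - P)"
    using i f by simp
  also have "\<dots> = (\<integral>x. \<bar>f' x - v x\<bar> \<partial>lborel) + (P' - P)"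
    using m f'(2) by (simp add: integral_completion)
  finally show ?thesis .
qed

text \<open>The functions \<open>f\<close> and \<open>g\<close> are replaced by log-concave majorants \<open>f'\<close> and \<open>g'\<close> that still satisfy the
  hypothesis with the same \<open>m\<close>. The inequality for the majorants shows that their masses exceed those
  of \<open>f\<close> and \<open>g\<close> by a factor of at most \<open>1 + 3 * \<epsilon>\<close>, which costs an error of order
  \<open>\<epsilon> \<le> root 3 \<epsilon>\<close> in \<open>L\<^sup>1\<close>.\<close>

lemma prekopa_leindler_stability:
  fixes m f g :: "real \<Rightarrow> real" and \<epsilon> :: real
  assumes f: "\<And>t. 0 \<le> f t" "integrable lebesgue f" "0 < (\<integral>t. f t \<partial>lebesgue)"
    and g: "\<And>t. 0 \<le> g t" "integrable lebesgue g" "0 < (\<integral>t. g t \<partial>lebesgue)"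
    and m: "log_concave m" "integrable lebesgue m" "0 < (\<integral>t. m t \<partial>lebesgue)"
    and dom: "\<And>r s. sqrt (f r * g s) \<le> m ((r + s) / 2)"
    and \<epsilon>: "0 < \<epsilon>"
    and le: "(\<integral>t. m t \<partial>lebesgue) \<le> (1 + \<epsilon>) * sqrt ((\<integral>t. f t \<partial>lebesgue) * (\<integral>t. g t \<partial>lebesgue))"
  shows "\<exists>a b. 0 < a
    \<and> (\<integral>t. \<bar>f t - a * m (t + b)\<bar> \<partial>lebesgue) \<le> 37 * root 3 \<epsilon> * (a * (\<integral>t. m t \<partial>lebesgue))
    \<and> (\<integral>t. \<bar>g t - inverse a * m (t - b)\<bar> \<partial>lebesgue)
        \<le> 37 * root 3 \<epsilon> * (inverse a * (\<integral>t. m t \<partial>lebesgue))"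
proof -
  define M where "M = (\<integral>t. m t \<partial>lborel)"
  have m_meas: "m \<in> borel_measurable lborel" using log_concave_borel_measurable[OF m(1)] by simp
  have mM: "(\<integral>t. m t \<partial>lebesgue) = M" unfolding M_def by (rule integral_completion[OF m_meas])
  have mi: "integrable lborel m" using m(2) integrable_completion[OF m_meas] by simp
  have M: "0 < M" using m(3) mM by simp
  define f' where "f' = envelope m g"
  define g' where "g' = envelope m f'"
  have g_pos: "\<exists>s. 0 < g s" using integral_pos_imp_ex_pos[OF g(3,1)] .
  have f_pos: "\<exists>s. 0 < f s" using integral_pos_imp_ex_pos[OF f(3,1)] .
  have f'_nonneg: "0 \<le> f' s" for s unfolding f'_def by (rule envelope_nonneg[OF m(1) g(1) g_pos])
  have ff': "f r \<le> f' r" for r unfolding f'_def by (rule le_envelope[OF m(1) g(1) g_pos dom])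
  have f'_pos: "\<exists>s. 0 < f' s" using f_pos ff' by (meson less_le_trans)
  have dom': "sqrt (g s * f' r) \<le> m ((s + r) / 2)" for r s
    using envelope_dominated[OF m(1) g(1) g_pos, of r s] by (simp add: f'_def mult.commute add.commute)
  have gg': "g r \<le> g' r" for r unfolding g'_def by (rule le_envelope[OF m(1) f'_nonneg f'_pos dom'])
  have dom'': "sqrt (f' r * g' s) \<le> m ((r + s) / 2)" for r s
    using envelope_dominated[OF m(1) f'_nonneg f'_pos, of s r] by (simp add: g'_def mult.commute add.commute)
  have f': "log_concave f'" "integrable lborel f'"
    unfolding f'_def using log_concave_envelope[OF m(1) g(1) g_pos]
      integrable_envelope[OF m(1) g(1) g_pos mi] M by (simp_all add: M_def)
  have g': "log_concave g'" "integrable lborel g'"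
    unfolding g'_def using log_concave_envelope[OF m(1) f'_nonneg f'_pos]
      integrable_envelope[OF m(1) f'_nonneg f'_pos mi] M by (simp_all add: M_def)
  define p p' q q' where "p = (\<integral>t. f t \<partial>lebesgue)" and "p' = (\<integral>t. f' t \<partial>lborel)"
    and "q = (\<integral>t. g t \<partial>lebesgue)" and "q' = (\<integral>t. g' t \<partial>lborel)"
  have pp': "p \<le> p'"
  proof -
    have "p \<le> (\<integral>t. f' t \<partial>lebesgue)"
      unfolding p_def using f'(2) ff'
      by (intro integral_mono f(2)) (auto simp: integrable_completion borel_measurable_integrable)
    also have "\<dots> = p'" unfolding p'_def using f'(2) by (intro integral_completion) auto
    finally show ?thesis .
  qed
  have qq': "q \<le> q'"
  proof -
    have "q \<le> (\<integral>t. g' t \<partial>lebesgue)"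
      unfolding q_def using g'(2) gg'
      by (intro integral_mono g(2)) (auto simp: integrable_completion borel_measurable_integrable)
    also have "\<dots> = q'" unfolding q'_def using g'(2) by (intro integral_completion) auto
    finally show ?thesis .
  qed
  have pos: "0 < p" "0 < q" "0 < p'" "0 < q'" using f(3) g(3) pp' qq' by (auto simp: p_def q_def)
  define a where "a = sqrt (p' / q')"
  have a: "0 < a" using pos by (simp add: a_def)
  define R where "R = sqrt (p' * q')"
  have aR: "p' = a * R" "q' = inverse a * R"
    using pos by (simp_all add: a_def R_def real_sqrt_mult real_sqrt_divide field_simps)
  note stab = stability_log_concave[OF f' p'_def[symmetric] pos(3) g' q'_def[symmetric] pos(4)
      m(1) mi M_def[symmetric] dom'', folded a_def R_def]
  have p'_le: "p' \<le> a * M" and q'_le: "q' \<le> inverse a * M"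
    unfolding aR using stab(1) a by simp_all
  have le': "M \<le> (1 + \<epsilon>) * sqrt (p * q)" using le by (simp add: mM p_def q_def)
  have h: "0 \<le> root 3 \<epsilon>" using \<epsilon> by simp
  have mshift: "integrable lborel (\<lambda>t. k * m (t + b))" for k b
    using lborel_integrable_real_affine[OF mi, of 1 b] by (simp add: add.commute)
  show ?thesis
  proof (cases "\<epsilon> < 1/8")
    case True
    have "M \<le> (1 + \<epsilon>) * R"
    proof -
      have "sqrt (p * q) \<le> R" unfolding R_def using pp' qq' pos by (intro real_sqrt_le_mono mult_mono) auto
      then have "(1 + \<epsilon>) * sqrt (p * q) \<le> (1 + \<epsilon>) * R" using \<epsilon> by (intro mult_left_mono) auto
      with le' show ?thesis by simp
    qed
    from stab(2)[OF \<epsilon> True this] obtain b where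
      b: "(\<integral>t. \<bar>f' t - a * m (t + b)\<bar> \<partial>lborel) \<le> 34 * root 3 \<epsilon> * (a * M)"
         "(\<integral>t. \<bar>g' t - inverse a * m (t - b)\<bar> \<partial>lborel) \<le> 34 * root 3 \<epsilon> * (inverse a * M)" by blast
    have prod: "p' * q' \<le> (1 + 3 * \<epsilon>) * (p * q)"
    proof -
      have "R \<le> (1 + \<epsilon>) * sqrt (p * q)" using stab(1) le' by simp
      then have "R\<^sup>2 \<le> ((1 + \<epsilon>) * sqrt (p * q))\<^sup>2" using pos by (intro power_mono) (auto simp: R_def)
      then have "p' * q' \<le> (1 + \<epsilon>)\<^sup>2 * (p * q)" using pos by (simp add: R_def power_mult_distrib)
      also have "(1 + \<epsilon>)\<^sup>2 \<le> 1 + 3 * \<epsilon>"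
        using mult_left_mono[of \<epsilon> 1 \<epsilon>] \<epsilon> True by (simp add: power2_eq_square algebra_simps)
      finally show ?thesis using pos by simp
    qed
    have p_gap: "p' - p \<le> 3 * \<epsilon> * p'"
    proof -
      note prod
      also have "(1 + 3 * \<epsilon>) * (p * q) \<le> (1 + 3 * \<epsilon>) * (p * q')"
        using qq' pos \<epsilon> by (intro mult_left_mono) auto
      finally have "p' * q' \<le> ((1 + 3 * \<epsilon>) * p) * q'" by (simp only: mult.assoc)
      then have "p' \<le> (1 + 3 * \<epsilon>) * p" using pos(4) by (rule mult_right_le_imp_le)
      also have "\<dots> \<le> p + 3 * \<epsilon> * p'" using pp' \<epsilon> by (simp add: algebra_simps)
      finally show ?thesis by simp
    qed
    have q_gap: "q' - q \<le> 3 * \<epsilon> * q'"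
    proof -
      note prod
      also have "(1 + 3 * \<epsilon>) * (p * q) \<le> (1 + 3 * \<epsilon>) * (p' * q)"
        using pp' pos \<epsilon> by (intro mult_left_mono mult_right_mono) auto
      finally have "q' * p' \<le> ((1 + 3 * \<epsilon>) * q) * p'" by (simp only: ac_simps)
      then have "q' \<le> (1 + 3 * \<epsilon>) * q" using pos(3) by (rule mult_right_le_imp_le)
      also have "\<dots> \<le> q + 3 * \<epsilon> * q'" using qq' \<epsilon> by (simp add: algebra_simps)
      finally show ?thesis by simp
    qed
    have \<epsilon>h: "\<epsilon> \<le> root 3 \<epsilon>"
    proof -
      have "root 3 \<epsilon> \<le> 1" using True by simp
      then have "root 3 \<epsilon> ^ 3 \<le> root 3 \<epsilon> ^ 1" using h by (intro power_decreasing) auto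
      then show ?thesis using \<epsilon> by simp
    qed
    have gap: "3 * \<epsilon> * k \<le> 3 * root 3 \<epsilon> * l" if "0 \<le> k" "k \<le> l" for k l
      using \<epsilon>h that h by (intro mult_mono) auto
    show ?thesis unfolding mM
    proof (intro exI conjI)
      have "(\<integral>t. \<bar>f t - a * m (t + b)\<bar> \<partial>lebesgue)
          \<le> (\<integral>t. \<bar>f' t - a * m (t + b)\<bar> \<partial>lborel) + (p' - p)"
        by (rule L1_dist_via_majorant[OF f(2) p_def[symmetric] f'(2) p'_def[symmetric] mshift ff'])
      then show "(\<integral>t. \<bar>f t - a * m (t + b)\<bar> \<partial>lebesgue) \<le> 37 * root 3 \<epsilon> * (a * M)"
        using b(1) p_gap gap[of p' "a * M"] p'_le pos by simp
      have "(\<integral>t. \<bar>g t - inverse a * m (t - b)\<bar> \<partial>lebesgue)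
          \<le> (\<integral>t. \<bar>g' t - inverse a * m (t - b)\<bar> \<partial>lborel) + (q' - q)"
        using L1_dist_via_majorant[OF g(2) q_def[symmetric] g'(2) q'_def[symmetric] mshift gg', of "inverse a" "- b"]
        by simp
      then show "(\<integral>t. \<bar>g t - inverse a * m (t - b)\<bar> \<partial>lebesgue) \<le> 37 * root 3 \<epsilon> * (inverse a * M)"
        using b(2) q_gap gap[of q' "inverse a * M"] q'_le pos by simp
    qed (rule a)
  next
    case False
    \<comment> \<open>For large \<open>\<epsilon>\<close> the triangle inequality suffices, with \<open>b = 0\<close>.\<close>
    have half: "1/2 \<le> root 3 \<epsilon>"
    proof -
      have "root 3 ((1/2) ^ 3) \<le> root 3 \<epsilon>" using False by (simp add: power3_eq_cube)
      then show ?thesis by (simp only: real_root_pos2[of 3 "1/2"] zero_less_numeral)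
    qed
    have crude: "(\<integral>t. \<bar>u t - k * m t\<bar> \<partial>lebesgue) \<le> 37 * root 3 \<epsilon> * (k * M)"
      if u: "\<And>t. 0 \<le> u t" "integrable lebesgue u" "(\<integral>t. u t \<partial>lebesgue) \<le> k * M" and k: "0 < k"
      for u :: "real \<Rightarrow> real" and k
    proof -
      have "(\<integral>t. \<bar>u t - k * m t\<bar> \<partial>lebesgue) \<le> (\<integral>t. u t + k * m t \<partial>lebesgue)"
      proof (rule integral_mono)
        show "\<bar>u t - k * m t\<bar> \<le> u t + k * m t" for t
          using u(1)[of t] mult_nonneg_nonneg[OF less_imp_le[OF k] log_concave_nonneg[OF m(1), of t]] by simp
      qed (intro integrable_abs Bochner_Integration.integrable_add Bochner_Integration.integrable_diff
          integrable_mult_right u(2) m(2))+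
      also have "\<dots> = (\<integral>t. u t \<partial>lebesgue) + k * M" using u(2) m(2) mM by simp
      also have "\<dots> \<le> 4 * (1/2) * (k * M)" using u(3) by linarith
      also have "\<dots> \<le> 37 * root 3 \<epsilon> * (k * M)"
        using half k M by (intro mult_right_mono) auto
      finally show ?thesis .
    qed
    show ?thesis unfolding mM
    proof (intro exI conjI)
      show "(\<integral>t. \<bar>f t - a * m (t + 0)\<bar> \<partial>lebesgue) \<le> 37 * root 3 \<epsilon> * (a * M)"
        using crude[OF f(1,2) _ a] pp' p'_le by (simp add: p_def)
      show "(\<integral>t. \<bar>g t - inverse a * m (t - 0)\<bar> \<partial>lebesgue) \<le> 37 * root 3 \<epsilon> * (inverse a * M)"
        using crude[OF g(1,2), of "inverse a"] a qq' q'_le by (simp add: q_def)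
    qed (rule a)
  qed
qed

theorem theorem1p2:
  "\<exists>c::real. c > 0 \<and>
    (\<forall>(m::real \<Rightarrow> real) (f::real \<Rightarrow> real) (g::real \<Rightarrow> real) (\<epsilon>::real).
       (\<forall>t. 0 \<le> m t) \<and> (\<forall>t. 0 \<le> f t) \<and> (\<forall>t. 0 \<le> g t) \<and>
       integrable lebesgue m \<and> integrable lebesgue f \<and> integrable lebesgue g \<and>
       (LINT t|lebesgue. m t) > 0 \<and> (LINT t|lebesgue. f t) > 0 \<and> (LINT t|lebesgue. g t) > 0 \<and>
       log_concave m \<and>
       (\<forall>r s. m ((r + s) / 2) \<ge> sqrt (f r * g s)) \<and>
       \<epsilon> > 0 \<and>
       (LINT t|lebesgue. m t)
         \<le> (1 + \<epsilon>) * sqrt ((LINT t|lebesgue. f t) * (LINT t|lebesgue. g t))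
       \<longrightarrow>
       (\<exists>a b::real. a > 0 \<and>
          (LINT t|lebesgue. \<bar>f t - a * m (t + b)\<bar>)
            \<le> c * root 3 \<epsilon> * (max 1 \<bar>ln \<epsilon>\<bar>) powr (4 / 3) * a * (LINT t|lebesgue. m t) \<and>
          (LINT t|lebesgue. \<bar>g t - inverse a * m (t - b)\<bar>)
            \<le> c * root 3 \<epsilon> * (max 1 \<bar>ln \<epsilon>\<bar>) powr (4 / 3) * inverse a * (LINT t|lebesgue. m t)))"
proof (rule exI[of _ 37], intro conjI allI impI)
  fix m f g :: "real \<Rightarrow> real" and \<epsilon> :: real
  assume *: "(\<forall>t. 0 \<le> m t) \<and> (\<forall>t. 0 \<le> f t) \<and> (\<forall>t. 0 \<le> g t) \<and>
       integrable lebesgue m \<and> integrable lebesgue f \<and> integrable lebesgue g \<and>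
       (LINT t|lebesgue. m t) > 0 \<and> (LINT t|lebesgue. f t) > 0 \<and> (LINT t|lebesgue. g t) > 0 \<and>
       log_concave m \<and>
       (\<forall>r s. m ((r + s) / 2) \<ge> sqrt (f r * g s)) \<and>
       \<epsilon> > 0 \<and>
       (LINT t|lebesgue. m t)
         \<le> (1 + \<epsilon>) * sqrt ((LINT t|lebesgue. f t) * (LINT t|lebesgue. g t))"
  define M where "M = (LINT t|lebesgue. m t)"
  define L where "L = (max 1 \<bar>ln \<epsilon>\<bar>) powr (4 / 3)"
  \<comment> \<open>The logarithmic factor is at least one, so it only weakens the bound.\<close>
  have L: "1 \<le> L" unfolding L_def by (rule ge_one_powr_ge_zero) auto
  obtain a b where ab: "0 < a"
    "(LINT t|lebesgue. \<bar>f t - a * m (t + b)\<bar>) \<le> 37 * root 3 \<epsilon> * (a * M)"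
    "(LINT t|lebesgue. \<bar>g t - inverse a * m (t - b)\<bar>) \<le> 37 * root 3 \<epsilon> * (inverse a * M)"
    using prekopa_leindler_stability[of f g m \<epsilon>] * unfolding M_def by blast
  have weaken: "37 * root 3 \<epsilon> * (k * M) \<le> 37 * root 3 \<epsilon> * L * k * M" if "0 < k" for k
  proof -
    have "0 \<le> 37 * root 3 \<epsilon> * (k * M)" using * that by (simp add: M_def)
    from mult_right_mono[OF L this] show ?thesis by (simp add: ac_simps)
  qed
  have "(LINT t|lebesgue. \<bar>f t - a * m (t + b)\<bar>) \<le> 37 * root 3 \<epsilon> * L * a * M"
    using ab(2) weaken[OF ab(1)] by linarith
  moreover have "(LINT t|lebesgue. \<bar>g t - inverse a * m (t - b)\<bar>) \<le> 37 * root 3 \<epsilon> * L * inverse a * M"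
    using ab(3) weaken[of "inverse a"] ab(1) by simp
  ultimately show "\<exists>a b::real. a > 0 \<and>
          (LINT t|lebesgue. \<bar>f t - a * m (t + b)\<bar>)
            \<le> 37 * root 3 \<epsilon> * (max 1 \<bar>ln \<epsilon>\<bar>) powr (4 / 3) * a * (LINT t|lebesgue. m t) \<and>
          (LINT t|lebesgue. \<bar>g t - inverse a * m (t - b)\<bar>)
            \<le> 37 * root 3 \<epsilon> * (max 1 \<bar>ln \<epsilon>\<bar>) powr (4 / 3) * inverse a * (LINT t|lebesgue. m t)"
    using ab(1) unfolding M_def L_def by blast
qed simp

end
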